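(* For $c\in\mathbb{R}\setminus\{0\}$ let $d=\frac{\sigma}{2}-\frac{g}{\sigma}$ and $T_{c,d}=\inf\{t\ge 0: B_t=c+dt\}$, and let $$ST(t,P_t)=-\frac12e^{-\rho t}\left(\frac{D_tP_te^{rt}}{P_0}-1\right).$$ Under the model and assumptions in the context: (1) $\mathbb{E}\left[ST(T_{c,d},P_{T_{c,d}})\right]>0$ when $c<0$; (2) $\mathbb{E}\left[ST(T_{c,d},P_{T_{c,d}})\right]<0$ when $c>0$.
   Context: Model. $B$ is a standard Brownian motion. The price $P_t$ of a liquid staking token in ETH satisfies $dP_t/P_t=g\,dt+\sigma\,dB_t$ with deterministic initial price $P_0$, $g\ge 0$, $\sigma>0$. $D_t=e^{-mt}$ with $m>0$ is an exit discount factor, $r\ge 0$ is the staking reward rate, $\rho\ge 0$ is the investor's discount rate. The token is either rebasing ($P_0=1$, $g=0$, $r>0$) or reward-bearing ($P_0>1$, $g>0$, $r=0$). Standing assumptions: - $r+g-\rho-m>\ln P_0>0$; - $\left(\frac{\sigma}{2}-\frac{g}{\sigma}\right)^2-2(g+r-m-\rho)>0$; - $\left(\frac{\sigma}{2}-\frac{g}{\sigma}\right)^2-\left(g-\frac14\sigma^2-m-2\rho\right)>0$; - $d=\frac{\sigma}{2}-\frac{g}{\sigma}>0$; - $\frac14\sigma^2-m>0$. With $L=P_0e^{\sigma c}$, $T_{c,d}$ is the first time $P$ reaches level $L$ (from below if $c>0$, from above if $c<0$). On $\{T_{c,d}=\infty\}$ the payoff is taken to be $0$, so that expectations are computed through the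 Laplace transform $\mathbb{E}(e^{-\lambda T_{c,d}})=\exp(-c(d+\sqrt{d^2+2\lambda}))$ for $c>0$ and $\exp(-c(d-\sqrt{d^2+2\lambda}))$ for $c<0$. *)

theory Defs
  imports "HOL-Probability.Probability"
begin

text \<open>
  Time is \<open>[0,\<infinity>)\<close>, embedded in \<open>real\<close>. A filtration on \<open>[0,\<infinity>)\<close> is extended to negative indices
  by \<open>F t = F 0\<close>; processes are only constrained at nonnegative times.
\<close>

definition continuous_adapted ::
  "'a measure \<Rightarrow> (real \<Rightarrow> 'a measure) \<Rightarrow> (real \<Rightarrow> 'a \<Rightarrow> real) \<Rightarrow> bool" where
  "continuous_adapted M F X \<longleftrightarrow>
     (\<forall>t\<ge>0. X t \<in> borel_measurable (F t)) \<and>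
     (\<forall>\<omega>\<in>space M. continuous_on {0..} (\<lambda>t. X t \<omega>))"

text \<open>
  Standard Brownian motion relative to a filtration. The natural filtration of the process is
  allowed, for which this is the usual definition by independent Gaussian increments.
\<close>

locale brownian_motion = prob_space M + filtration "space M" F
  for M :: "'a measure" and F :: "real \<Rightarrow> 'a measure" +
  fixes B :: "real \<Rightarrow> 'a \<Rightarrow> real"
  assumes subalgebra_F: "\<And>t. subalgebra M (F t)"
    and continuous_adapted_B: "continuous_adapted M F B"
    and B_0: "\<And>\<omega>. \<omega> \<in> space M \<Longrightarrow> B 0 \<omega> = 0"
    and distributed_increment: "\<And>s t. 0 \<le> s \<Longrightarrow> s < t \<Longrightarrow>
      distributed M lborel (\<lambda>\<omega>. B t \<omega> - B s \<omega>) (normal_density 0 (sqrt (t - s)))"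
    and indep_increment: "\<And>s t. 0 \<le> s \<Longrightarrow> s < t \<Longrightarrow>
      indep_set (sets (F s)) (sets (vimage_algebra (space M) (\<lambda>\<omega>. B t \<omega> - B s \<omega>) borel))"

definition tendsto_in_prob ::
  "'a measure \<Rightarrow> (nat \<Rightarrow> 'a \<Rightarrow> real) \<Rightarrow> ('a \<Rightarrow> real) \<Rightarrow> bool" where
  "tendsto_in_prob M X Y \<longleftrightarrow>
     (\<forall>\<epsilon>>0. (\<lambda>n. measure M {\<omega> \<in> space M. \<bar>X n \<omega> - Y \<omega>\<bar> > \<epsilon>}) \<longlonglongrightarrow> 0)"

text \<open>
  The It\^o integral \<open>I = \<integral>\<^sub>0\<^sup>t H\<^sub>s dB\<^sub>s\<close> of a continuous adapted integrand: the limit in probability of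
  the left-endpoint sums. For such integrands the limit exists along every sequence of
  partitions of \<open>[0,t]\<close> with mesh tending to zero and does not depend on the sequence, so the
  uniform partitions suffice to determine \<open>I\<close> (up to a null set).
\<close>

definition has_ito_integral ::
  "'a measure \<Rightarrow> (real \<Rightarrow> 'a measure) \<Rightarrow> (real \<Rightarrow> 'a \<Rightarrow> real) \<Rightarrow> (real \<Rightarrow> 'a \<Rightarrow> real) \<Rightarrow>
    real \<Rightarrow> ('a \<Rightarrow> real) \<Rightarrow> bool" where
  "has_ito_integral M F B H t I \<longleftrightarrow>
     continuous_adapted M F H \<and> I \<in> borel_measurable M \<and>
     tendsto_in_prob M
       (\<lambda>n \<omega>. \<Sum>i<n. H (t * real i / real n) \<omega> *
                (B (t * real (Suc i) / real n) \<omega> - B (t * real i / real n) \<omega>)) I"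

text \<open>
  \<open>dP\<^sub>t / P\<^sub>t = g dt + \<sigma> dB\<^sub>t\<close> with deterministic initial value \<open>P\<^sub>0\<close>, in the usual integral form
  \<open>P\<^sub>t = P\<^sub>0 + \<integral>\<^sub>0\<^sup>t g P\<^sub>s ds + \<integral>\<^sub>0\<^sup>t \<sigma> P\<^sub>s dB\<^sub>s\<close>.
\<close>

definition price_process ::
  "'a measure \<Rightarrow> (real \<Rightarrow> 'a measure) \<Rightarrow> (real \<Rightarrow> 'a \<Rightarrow> real) \<Rightarrow> real \<Rightarrow> real \<Rightarrow> real \<Rightarrow>
    (real \<Rightarrow> 'a \<Rightarrow> real) \<Rightarrow> bool" where
  "price_process M F B g \<sigma> P0 P \<longleftrightarrow>
     continuous_adapted M F P \<and> (\<forall>\<omega>\<in>space M. P 0 \<omega> = P0) \<and>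
     (\<forall>t\<ge>0. \<exists>I. has_ito_integral M F B (\<lambda>s \<omega>. \<sigma> * P s \<omega>) t I \<and>
        (AE \<omega> in M. P t \<omega> = P0 + integral {0..t} (\<lambda>s. g * P s \<omega>) + I \<omega>))"

definition discount :: "real \<Rightarrow> real \<Rightarrow> real" where
  "discount m t = exp (- m * t)"

definition ST :: "real \<Rightarrow> real \<Rightarrow> real \<Rightarrow> real \<Rightarrow> real \<Rightarrow> real \<Rightarrow> real" where
  "ST \<rho> m r P0 t p =
     - (1 / 2) * exp (- \<rho> * t) * (discount m t * p * exp (r * t) / P0 - 1)"

text \<open>The infimum is taken in \<open>ereal\<close>, so it is \<open>\<infinity>\<close> when the line \<open>c + d t\<close> is never reached.\<close>

definition hitting_time :: "(real \<Rightarrow> 'a \<Rightarrow> real) \<Rightarrow> real \<Rightarrow> real \<Rightarrow> 'a \<Rightarrow> ereal" where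
  "hitting_time B c d \<omega> = Inf (ereal ` {t. 0 \<le> t \<and> B t \<omega> = c + d * t})"

text \<open>The value \<open>f(T, P\<^sub>T)\<close>, taken to be \<open>0\<close> on \<open>{T = \<infinity>}\<close>.\<close>

definition value_at ::
  "('a \<Rightarrow> ereal) \<Rightarrow> (real \<Rightarrow> real \<Rightarrow> real) \<Rightarrow> (real \<Rightarrow> 'a \<Rightarrow> real) \<Rightarrow> 'a \<Rightarrow> real" where
  "value_at T f P \<omega> =
     (if T \<omega> = \<infinity> then 0 else f (real_of_ereal (T \<omega>)) (P (real_of_ereal (T \<omega>)) \<omega>))"

end

theory Submission
  imports Defs "HOL-Real_Asymp.Real_Asymp"
begin

text \<open>
  The price is \<open>P\<^sub>t = P\<^sub>0 exp (\<sigma> (B\<^sub>t - d t))\<close> almost surely, so \<open>P\<^sub>T = P\<^sub>0 exp (\<sigma> c)\<close> on \<open>T < \<infinity>\<close>; as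
  \<open>ln P\<^sub>0 > 0\<close> forces \<open>r = 0\<close>, the payoff is \<open>- (exp (\<sigma> c - (m + \<rho>) T) - exp (- \<rho> T)) / 2\<close> there.
  For \<open>c < 0\<close> it is positive pointwise, and \<open>T < \<infinity>\<close> has positive probability because otherwise
  \<open>0 = E B\<^sub>t \<ge> c + d t\<close> for all \<open>t\<close>. For \<open>c > 0\<close> the Laplace transform of \<open>T\<close> (optional stopping of
  the exponential martingale) reduces the claim to
  \<open>sqrt (d\<^sup>2 + 2 (m + \<rho>)) < sqrt (d\<^sup>2 + 2 \<rho>) + \<sigma>\<close>, which follows from \<open>4 m < \<sigma>\<^sup>2\<close>.

  The explicit form of \<open>P\<close> is obtained by comparing it on \<open>[0,t]\<close> with the Euler scheme for \<open>n\<close>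
  steps: truncating \<open>P\<close> at a level \<open>N\<close>, the difference has second moment at most a constant times
  the squared \<open>L\<^sup>2\<close> modulus of continuity of the truncated price at scale \<open>t/n\<close>, and the second
  moment of the difference between the Euler scheme and the exponential is explicit.
\<close>

subsection \<open>Brownian increments\<close>

text \<open>Two obstacles shape the first half. The integral equation speaks of one time at a time,
  and its stochastic term is only a limit in probability along uniform partitions; and no moment
  bound on \<open>P\<close> is given. Against the first, the partitions of the intervals ending at
  the various Euler nodes are chosen as pieces of one common fine grid, so that a single subsequence
  yields almost sure convergence at all nodes together. Against the second, the moment estimate is
  run with the truncated price, which is bounded, and its outcome is read off only on paths that
  stay in \<open>[-N, N]\<close> up to time \<open>t\<close>; by continuity every path does so for
  some \<open>N\<close>. The link to hitting lines is \<sigma> d = \<sigma>^2/2 - g: the exponent of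
  the price is \<sigma> (B - d t), so it equals \<sigma> c when \<open>B\<close> meets the line. In
  the case c > 0 the two discounted terms enter with opposite signs. The one with rate m + \<rho> >
  0 needs the exact Laplace transform, while for the rate \<rho>, which may be 0, an upper bound is
  enough; this is why the transform is proved as an inequality for l \<ge> 0 and as an equality for
  l > 0.\<close>

lemma normal_density_mult_exp:
  assumes "0 < s"
  shows "normal_density 0 s x * exp (a * x) = exp (a\<^sup>2 * s\<^sup>2 / 2) * normal_density (a * s\<^sup>2) s x"
proof -
  \<comment> \<open>Completing the square: exponential tilting turns the normal law with mean 0 into
    the one with mean a s^2 and the same variance, so the exponential moments below are ordinary
    moments of a shifted normal law.\<close>
  have "- (x\<^sup>2 / (2 * s\<^sup>2)) + a * x = a\<^sup>2 * s\<^sup>2 / 2 - (x - a * s\<^sup>2)\<^sup>2 / (2 * s\<^sup>2)"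
    using assms by (simp add: field_simps power2_eq_square)
  then show ?thesis
    by (simp add: normal_density_def exp_add[symmetric])
qed

lemma normal_exp_moment:
  assumes "0 < s"
  shows "has_bochner_integral lborel (\<lambda>x. normal_density 0 s x * exp (a * x)) (exp (a\<^sup>2 * s\<^sup>2 / 2))"
proof -
  have "has_bochner_integral lborel (normal_density (a * s\<^sup>2) s) 1"
    using integrable_normal_density[OF assms] integral_normal_density[OF assms]
    by (simp add: has_bochner_integral_iff)
  then show ?thesis
    unfolding normal_density_mult_exp[OF assms]
    using has_bochner_integral_mult_right[of "exp (a\<^sup>2 * s\<^sup>2 / 2)" lborel] by force
qed

lemma normal_exp_moment_1:
  assumes "0 < s"
  shows "has_bochner_integral lborel (\<lambda>x. normal_density 0 s x * (x * exp (a * x)))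
           (a * s\<^sup>2 * exp (a\<^sup>2 * s\<^sup>2 / 2))"
proof -
  have "normal_density 0 s x * (x * exp (a * x)) =
      exp (a\<^sup>2 * s\<^sup>2 / 2) * (normal_density (a * s\<^sup>2) s x * x)" for x
    using normal_density_mult_exp[OF assms, of x a] by (simp add: mult_ac)
  then show ?thesis
    using has_bochner_integral_mult_right[OF normal_moment_nz_1[OF assms, of "a * s\<^sup>2"],
        of "exp (a\<^sup>2 * s\<^sup>2 / 2)"]
    by (simp only: mult.commute[of _ "a * s\<^sup>2"])
qed

lemma integrable_mult_of_squares:
  fixes X Y :: "'a \<Rightarrow> real"
  assumes [measurable]: "X \<in> borel_measurable M" "Y \<in> borel_measurable M"
    and "integrable M (\<lambda>\<omega>. (X \<omega>)\<^sup>2)" "integrable M (\<lambda>\<omega>. (Y \<omega>)\<^sup>2)"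
  shows "integrable M (\<lambda>\<omega>. X \<omega> * Y \<omega>)"
proof (rule Bochner_Integration.integrable_bound)
  show "integrable M (\<lambda>\<omega>. (X \<omega>)\<^sup>2 + (Y \<omega>)\<^sup>2)" using assms by auto
  have "\<bar>x * y\<bar> \<le> x\<^sup>2 + y\<^sup>2" for x y :: real
  proof -
    have "0 \<le> (\<bar>x\<bar> - \<bar>y\<bar>)\<^sup>2" "0 \<le> \<bar>x * y\<bar>" by simp_all
    then show ?thesis unfolding power2_diff abs_mult power2_abs by linarith
  qed
  then show "AE \<omega> in M. norm (X \<omega> * Y \<omega>) \<le> norm ((X \<omega>)\<^sup>2 + (Y \<omega>)\<^sup>2)" by auto
qed simp

context brownian_motion
begin

lemma measurable_F_mono: "s \<le> t \<Longrightarrow> X \<in> borel_measurable (F s) \<Longrightarrow> X \<in> borel_measurable (F t)"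
  using sets_F_mono[of s t] space_F by (auto simp: measurable_def)

lemma measurable_F: "X \<in> borel_measurable (F s) \<Longrightarrow> X \<in> borel_measurable M"
  using measurable_from_subalg[OF subalgebra_F] .

lemma B_measurable_F: "0 \<le> s \<Longrightarrow> s \<le> t \<Longrightarrow> B s \<in> borel_measurable (F t)"
  using continuous_adapted_B measurable_F_mono unfolding continuous_adapted_def by blast

lemma B_measurable: "0 \<le> s \<Longrightarrow> B s \<in> borel_measurable M"
  using B_measurable_F[of s s] measurable_F by auto

lemma increment_has_integral:
  assumes "0 \<le> s" "s < t" and f: "f \<in> borel_measurable borel"
    and I: "has_bochner_integral lborel (\<lambda>x. normal_density 0 (sqrt (t - s)) x * f x) (I::real)"
  shows "integrable M (\<lambda>\<omega>. f (B t \<omega> - B s \<omega>))" "expectation (\<lambda>\<omega>. f (B t \<omega> - B s \<omega>)) = I"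
  using distributed_integrable[OF distributed_increment[OF assms(1,2)], of f]
    distributed_integral[OF distributed_increment[OF assms(1,2)], of f] f I
  by (auto simp: has_bochner_integral_iff)

text \<open>The independence axiom is about sigma-algebras. The one generated by \<open>X\<close>
  lies inside \<open>F s\<close>, so independence passes to it by monotonicity, and composing with
  \<open>f\<close> preserves it.\<close>

lemma increment_indep_var:
  fixes X :: "'a \<Rightarrow> real" and f :: "real \<Rightarrow> real"
  assumes "0 \<le> s" "s < t" and X: "X \<in> borel_measurable (F s)"
    and f[measurable]: "f \<in> borel_measurable borel"
  shows "indep_var borel X borel (\<lambda>\<omega>. f (B t \<omega> - B s \<omega>) :: real)"
proof -
  let ?W = "\<lambda>\<omega>. B t \<omega> - B s \<omega>"
  have [measurable]: "random_variable borel (B t)" "random_variable borel (B s)"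
    using B_measurable assms by auto
  have [measurable]: "X \<in> borel_measurable M" using X measurable_F by auto
  have "indep_var borel X borel ?W"
    unfolding indep_var_eq
  proof (intro conjI)
    have "{X -` A \<inter> space M |A. A \<in> sets borel} \<subseteq> sets (F s)"
      using measurable_sets[OF X] by (auto simp: space_F)
    then have "sigma_sets (space M) {X -` A \<inter> space M |A. A \<in> sets borel} \<subseteq> sets (F s)"
      using sets.sigma_sets_subset[of _ "F s"] by (simp add: space_F)
    moreover have "sigma_sets (space M) {?W -` A \<inter> space M |A. A \<in> sets borel} \<subseteq>
        sets (vimage_algebra (space M) ?W borel)"
      by (simp add: sets_vimage_algebra)
    ultimately have "case_bool (sigma_sets (space M) {X -` A \<inter> space M |A. A \<in> sets borel})
        (sigma_sets (space M) {?W -` A \<inter> space M |A. A \<in> sets borel}) i \<subseteq>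
        case_bool (sets (F s)) (sets (vimage_algebra (space M) ?W borel)) i" for i
      by (cases i) simp_all
    then show "indep_set (sigma_sets (space M) {X -` A \<inter> space M |A. A \<in> sets borel})
        (sigma_sets (space M) {?W -` A \<inter> space M |A. A \<in> sets borel})"
      using indep_increment[OF assms(1,2)] unfolding indep_set_def
      by (rule_tac indep_sets_mono_sets)
  qed simp_all
  from indep_var_compose[OF this, of "\<lambda>x. x" borel f borel] show ?thesis
    by (simp add: comp_def)
qed

text \<open>This product rule does the work of conditioning on \<open>F s\<close>: every later use
  of the independence of increments (Euler products, second moments of one step, the exponential
  martingale) goes through it.\<close>

lemma increment_mult:
  fixes X :: "'a \<Rightarrow> real" and f :: "real \<Rightarrow> real"
  assumes "0 \<le> s" "s < t" and X: "X \<in> borel_measurable (F s)" "integrable M X"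
    and f: "f \<in> borel_measurable borel" "integrable M (\<lambda>\<omega>. f (B t \<omega> - B s \<omega>))"
  shows "integrable M (\<lambda>\<omega>. X \<omega> * f (B t \<omega> - B s \<omega>))"
    "expectation (\<lambda>\<omega>. X \<omega> * f (B t \<omega> - B s \<omega>)) =
       expectation X * expectation (\<lambda>\<omega>. f (B t \<omega> - B s \<omega>))"
  using indep_var_integrable[OF increment_indep_var[OF assms(1,2) X(1) f(1)] X(2) f(2)]
    indep_var_lebesgue_integral[OF increment_indep_var[OF assms(1,2) X(1) f(1)] X(2) f(2)] .

lemma increment_affine:
  assumes "0 \<le> s" "s < t"
  shows "integrable M (\<lambda>\<omega>. a + b * (B t \<omega> - B s \<omega>))"
    "expectation (\<lambda>\<omega>. a + b * (B t \<omega> - B s \<omega>)) = a"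
    "integrable M (\<lambda>\<omega>. (a + b * (B t \<omega> - B s \<omega>))\<^sup>2)"
    "expectation (\<lambda>\<omega>. (a + b * (B t \<omega> - B s \<omega>))\<^sup>2) = a\<^sup>2 + b\<^sup>2 * (t - s)"
proof -
  have pos: "0 < sqrt (t - s)" using assms by simp
  have 1: "has_bochner_integral lborel (\<lambda>x. normal_density 0 (sqrt (t - s)) x * x) 0"
    using normal_moment_nz_1[OF pos, of 0] .
  have 2: "has_bochner_integral lborel (\<lambda>x. normal_density 0 (sqrt (t - s)) x * x\<^sup>2) (t - s)"
    using normal_moment_even[OF pos, of 0 1] assms by (simp add: fact_numeral diff_divide_distrib)
  have i: "integrable M (\<lambda>\<omega>. B t \<omega> - B s \<omega>)" "expectation (\<lambda>\<omega>. B t \<omega> - B s \<omega>) = 0"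
    "integrable M (\<lambda>\<omega>. (B t \<omega> - B s \<omega>)\<^sup>2)" "expectation (\<lambda>\<omega>. (B t \<omega> - B s \<omega>)\<^sup>2) = t - s"
    using increment_has_integral[OF assms _ 1] increment_has_integral[OF assms _ 2] by auto
  show "integrable M (\<lambda>\<omega>. a + b * (B t \<omega> - B s \<omega>))"
    using i(1) by (intro Bochner_Integration.integrable_add integrable_mult_right) auto
  show "expectation (\<lambda>\<omega>. a + b * (B t \<omega> - B s \<omega>)) = a"
    using i(1) by (subst Bochner_Integration.integral_add)
      (simp_all add: i(2) prob_space del: Bochner_Integration.integral_diff)
  have eq: "(a + b * (B t \<omega> - B s \<omega>))\<^sup>2 =
      (a\<^sup>2 + (2 * a * b) * (B t \<omega> - B s \<omega>)) + b\<^sup>2 * (B t \<omega> - B s \<omega>)\<^sup>2" for \<omega>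
    by (simp add: power2_eq_square algebra_simps)
  have j: "integrable M (\<lambda>\<omega>. a\<^sup>2 + (2 * a * b) * (B t \<omega> - B s \<omega>))"
    "integrable M (\<lambda>\<omega>. b\<^sup>2 * (B t \<omega> - B s \<omega>)\<^sup>2)"
    "integrable M (\<lambda>\<omega>. (2 * a * b) * (B t \<omega> - B s \<omega>))" "integrable M (\<lambda>\<omega>. a\<^sup>2)"
    using i by (auto intro!: Bochner_Integration.integrable_add integrable_mult_right)
  show "integrable M (\<lambda>\<omega>. (a + b * (B t \<omega> - B s \<omega>))\<^sup>2)"
    unfolding eq using j by (intro Bochner_Integration.integrable_add)
  show "expectation (\<lambda>\<omega>. (a + b * (B t \<omega> - B s \<omega>))\<^sup>2) = a\<^sup>2 + b\<^sup>2 * (t - s)"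
    unfolding eq Bochner_Integration.integral_add[OF j(1,2)] Bochner_Integration.integral_add[OF j(4,3)]
    using i by (simp add: prob_space del: Bochner_Integration.integral_diff)
qed

lemma increment_exp:
  assumes "0 \<le> s" "s < t"
  shows "integrable M (\<lambda>\<omega>. exp (a * (B t \<omega> - B s \<omega>)))"
    "expectation (\<lambda>\<omega>. exp (a * (B t \<omega> - B s \<omega>))) = exp (a\<^sup>2 * (t - s) / 2)"
    "integrable M (\<lambda>\<omega>. (B t \<omega> - B s \<omega>) * exp (a * (B t \<omega> - B s \<omega>)))"
    "expectation (\<lambda>\<omega>. (B t \<omega> - B s \<omega>) * exp (a * (B t \<omega> - B s \<omega>))) =
       a * (t - s) * exp (a\<^sup>2 * (t - s) / 2)"
proof -
  have pos: "0 < sqrt (t - s)" using assms by simp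
  show "integrable M (\<lambda>\<omega>. exp (a * (B t \<omega> - B s \<omega>)))"
    "expectation (\<lambda>\<omega>. exp (a * (B t \<omega> - B s \<omega>))) = exp (a\<^sup>2 * (t - s) / 2)"
    using increment_has_integral[OF assms _ normal_exp_moment[OF pos, of a]] assms by auto
  show "integrable M (\<lambda>\<omega>. (B t \<omega> - B s \<omega>) * exp (a * (B t \<omega> - B s \<omega>)))"
    "expectation (\<lambda>\<omega>. (B t \<omega> - B s \<omega>) * exp (a * (B t \<omega> - B s \<omega>))) =
       a * (t - s) * exp (a\<^sup>2 * (t - s) / 2)"
    using increment_has_integral[OF assms _ normal_exp_moment_1[OF pos, of a]] assms by auto
qed

text \<open>The first \<open>n\<close> factors depend only on the past of time \<open>n h\<close>
  and the next factor is independent of that past, so the expectation splits off one factor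
  \<open>q\<close> per step. Adaptedness is carried through the induction because the product rule
  asks for it.\<close>

lemma expectation_prod_increments:
  fixes u :: "real \<Rightarrow> real"
  assumes [measurable]: "u \<in> borel_measurable borel" and "0 < h"
    and u: "\<And>s. 0 \<le> s \<Longrightarrow> integrable M (\<lambda>\<omega>. u (B (s + h) \<omega> - B s \<omega>))"
      "\<And>s. 0 \<le> s \<Longrightarrow> expectation (\<lambda>\<omega>. u (B (s + h) \<omega> - B s \<omega>)) = q"
  defines "R \<equiv> \<lambda>n \<omega>. \<Prod>i<n. u (B (real (Suc i) * h) \<omega> - B (real i * h) \<omega>)"
  shows "R n \<in> borel_measurable (F (real n * h)) \<and> integrable M (R n) \<and> expectation (R n) = q ^ n"
proof (induction n)
  case 0
  then show ?case by (simp add: R_def prob_space)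
next
  case (Suc n)
  have eq: "R (Suc n) = (\<lambda>\<omega>. R n \<omega> * u (B (real (Suc n) * h) \<omega> - B (real n * h) \<omega>))"
    by (simp add: R_def)
  have step: "real n * h + h = real (Suc n) * h" by (simp add: algebra_simps)
  have lt: "0 \<le> real n * h" "real n * h < real (Suc n) * h" using \<open>0 < h\<close> by auto
  have [measurable]: "R n \<in> borel_measurable (F (real (Suc n) * h))"
    using Suc measurable_F_mono[OF less_imp_le[OF lt(2)]] by blast
  have [measurable]: "B (real (Suc n) * h) \<in> borel_measurable (F (real (Suc n) * h))"
    "B (real n * h) \<in> borel_measurable (F (real (Suc n) * h))"
    using lt by (auto intro!: B_measurable_F simp del: of_nat_Suc)
  have "R (Suc n) \<in> borel_measurable (F (real (Suc n) * h))"
    unfolding eq by measurable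
  with increment_mult[OF lt, of "R n" u] Suc u[OF lt(1)] show ?case
    by (simp add: eq step)
qed

end

subsection \<open>Left sums and the Euler scheme\<close>

text \<open>Uniform continuity makes the error on one cell at most \<epsilon> times its length, and
  the cell lengths add up to \<open>t\<close>.\<close>

lemma left_sums_tendsto_integral:
  fixes f :: "real \<Rightarrow> real"
  assumes cont: "continuous_on {0..t} f" and "0 \<le> t"
  shows "(\<lambda>n. \<Sum>i<n. f (t * real i / real n) * (t / real n)) \<longlonglongrightarrow> integral {0..t} f"
proof (rule LIMSEQ_I)
  fix e :: real assume "0 < e"
  \<comment> \<open>The \<open>+ 1\<close> keeps the denominator positive at t = 0 and still gives
    \<epsilon> t \<le> e/2.\<close>
  define \<epsilon> where "\<epsilon> = e / (2 * (t + 1))"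
  have "0 < \<epsilon>" using \<open>0 < e\<close> \<open>0 \<le> t\<close> by (simp add: \<epsilon>_def)
  have "uniformly_continuous_on {0..t} f"
    using cont by (rule compact_uniformly_continuous) simp
  from this[unfolded uniformly_continuous_on_def, rule_format, OF \<open>0 < \<epsilon>\<close>]
  obtain \<delta> where "0 < \<delta>" and
    \<delta>: "\<And>x y. x \<in> {0..t} \<Longrightarrow> y \<in> {0..t} \<Longrightarrow> dist y x < \<delta> \<Longrightarrow> dist (f y) (f x) < \<epsilon>"
    by blast
  obtain n0 where n0: "t / \<delta> < real n0" using reals_Archimedean2 by blast
  show "\<exists>no. \<forall>n\<ge>no. norm ((\<Sum>i<n. f (t * real i / real n) * (t / real n)) - integral {0..t} f) < e"
  proof (intro exI allI impI)
    fix n assume n: "Suc n0 \<le> n"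
    define h where "h = t / real n"
    have "t / \<delta> < real n"
      using n0 n by linarith
    then have "t < \<delta> * real n"
      using \<open>0 < \<delta>\<close> by (simp add: pos_divide_less_eq mult.commute)
    then have h: "0 \<le> h" "h < \<delta>" "real n * h = t"
      using n \<open>0 \<le> t\<close> by (auto simp: h_def field_simps)
    \<comment> \<open>The error is accumulated cell by cell over the partial intervals up to
      \<open>l h\<close>; the claim is the case l = n.\<close>
    have "\<bar>(\<Sum>i<l. f (real i * h) * h) - integral {0..real l * h} f\<bar> \<le> real l * (\<epsilon> * h)"
      if "l \<le> n" for l
      using that
    proof (induction l)
      case (Suc l)
      let ?a = "real l * h" and ?b = "real (Suc l) * h"
      have ab: "0 \<le> ?a" "?a \<le> ?b" "?b \<le> t" "?b - ?a = h"
        using h Suc.prems mult_right_mono[of "real (Suc l)" "real n" h] by (auto simp: algebra_simps)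
      have int: "f integrable_on {0..?b}"
        using ab by (intro integrable_continuous_real continuous_on_subset[OF cont]) auto
      have int': "f integrable_on {?a..?b}"
        using ab by (intro integrable_continuous_real continuous_on_subset[OF cont]) auto
      have "norm (integral {?a..?b} (\<lambda>x. f x - f ?a)) \<le> \<epsilon> * (?b - ?a)"
      proof (rule integral_bound)
        show "continuous_on {?a..?b} (\<lambda>x. f x - f ?a)"
          using ab by (intro continuous_intros continuous_on_subset[OF cont]) auto
        show "norm (f x - f ?a) \<le> \<epsilon>" if "x \<in> {?a..?b}" for x
          using \<delta>[of ?a x] that ab(1,3,4) h(2) by (simp add: dist_real_def)
      qed (use ab in auto)
      moreover have "integral {?a..?b} (\<lambda>x. f x - f ?a) = integral {?a..?b} f - f ?a * h"
        using Henstock_Kurzweil_Integration.integral_diff[OF int' integrable_const_ivl, of "f ?a"] ab(2,4)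
        by (simp add: mult.commute del: of_nat_Suc)
      moreover have "integral {0..?b} f = integral {0..?a} f + integral {?a..?b} f"
        using Henstock_Kurzweil_Integration.integral_combine[OF ab(1,2) int] by simp
      ultimately show ?case
        using Suc ab(4) by (simp add: algebra_simps)
    qed simp
    from this[of n] have "\<bar>(\<Sum>i<n. f (real i * h) * h) - integral {0..t} f\<bar> \<le> \<epsilon> * t"
      using h by (simp add: mult_ac)
    also have "\<dots> < e"
    proof -
      have "\<epsilon> * t \<le> \<epsilon> * (t + 1)" using \<open>0 < \<epsilon>\<close> by simp
      also have "\<dots> = e / 2" using \<open>0 \<le> t\<close> by (simp add: \<epsilon>_def field_simps)
      finally show ?thesis using \<open>0 < e\<close> by linarith
    qed
    finally show "norm ((\<Sum>i<n. f (t * real i / real n) * (t / real n)) - integral {0..t} f) < e"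
      by (simp add: h_def mult_ac)
  qed
qed

text \<open>Convergence in probability is convergence to 0 in mean of the distance truncated at 1,
  which is integrable whatever \<open>X\<close> and \<open>Y\<close> are. Summing these distances
  over the finite index set before extracting a subsequence makes one subsequence serve all
  indices.\<close>

lemma (in prob_space) tendsto_in_prob_AE_subseq:
  assumes "finite I"
    and lim: "\<And>i. i \<in> I \<Longrightarrow> tendsto_in_prob M (X i) (Y i)"
    and X: "\<And>i n. i \<in> I \<Longrightarrow> X i n \<in> borel_measurable M"
    and Y: "\<And>i. i \<in> I \<Longrightarrow> Y i \<in> borel_measurable M"
  shows "\<exists>r::nat\<Rightarrow>nat. strict_mono r \<and> (AE \<omega> in M. \<forall>i\<in>I. (\<lambda>n. X i (r n) \<omega>) \<longlonglongrightarrow> Y i \<omega>)"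
proof -
  define v where "v = (\<lambda>i n \<omega>. min 1 \<bar>X i n \<omega> - Y i \<omega>\<bar>)"
  define u where "u = (\<lambda>n \<omega>. \<Sum>i\<in>I. v i n \<omega>)"
  have vM[measurable]: "v i n \<in> borel_measurable M" if "i \<in> I" for i n
    using X[OF that, of n] Y[OF that] unfolding v_def by measurable
  have v01: "0 \<le> v i n \<omega>" "v i n \<omega> \<le> 1" for i n \<omega> by (auto simp: v_def)
  have vint: "integrable M (v i n)" if "i \<in> I" for i n
    using v01 vM[OF that] by (intro integrable_const_bound[where B = 1]) auto
  have "(\<lambda>n. expectation (v i n)) \<longlonglongrightarrow> 0" if "i \<in> I" for i
  proof (rule LIMSEQ_I)
    fix e :: real assume "0 < e"
    let ?A = "\<lambda>n. {\<omega> \<in> space M. \<bar>X i n \<omega> - Y i \<omega>\<bar> > e / 2}"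
    have A: "?A n \<in> events" for n
      using X[OF that, of n] Y[OF that] by measurable
    have "(\<lambda>n. prob (?A n)) \<longlonglongrightarrow> 0"
      using lim[OF that] half_gt_zero[OF \<open>0 < e\<close>] unfolding tendsto_in_prob_def by blast
    then obtain n0 where n0: "\<And>n. n \<ge> n0 \<Longrightarrow> prob (?A n) < e / 2"
      using LIMSEQ_D[OF _ half_gt_zero[OF \<open>0 < e\<close>]] by fastforce
    show "\<exists>no. \<forall>n\<ge>no. norm (expectation (v i n) - 0) < e"
    proof (intro exI allI impI)
      fix n assume "n0 \<le> n"
      have int: "integrable M (indicator (?A n) :: 'a \<Rightarrow> real)"
        using A[of n] by (simp add: emeasure_eq_measure)
      have "expectation (v i n) \<le> expectation (\<lambda>\<omega>. e / 2 + indicator (?A n) \<omega>)"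
      proof (rule integral_mono[OF vint[OF that]])
        show "integrable M (\<lambda>\<omega>. e / 2 + indicator (?A n) \<omega>)"
          using int by (intro Bochner_Integration.integrable_add) simp_all
        show "v i n \<omega> \<le> e / 2 + indicator (?A n) \<omega>" if "\<omega> \<in> space M" for \<omega>
          using that \<open>0 < e\<close> by (simp add: v_def indicator_def min_def)
      qed
      also have "\<dots> = e / 2 + prob (?A n)"
        using int A[of n] by (subst Bochner_Integration.integral_add) (simp_all add: prob_space)
      finally show "norm (expectation (v i n) - 0) < e"
        using n0[OF \<open>n0 \<le> n\<close>] v01 by (simp add: Bochner_Integration.integral_nonneg)
    qed
  qed
  then have "(\<lambda>n. \<Sum>i\<in>I. expectation (v i n)) \<longlonglongrightarrow> (\<Sum>i\<in>I. 0)"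
    by (intro tendsto_sum)
  then have "(\<lambda>n. expectation (\<lambda>\<omega>. norm (u n \<omega>))) \<longlonglongrightarrow> 0"
    using vint v01 by (simp add: u_def Bochner_Integration.integral_sum sum_nonneg)
  moreover have "integrable M (u n)" for n
    using vint by (auto simp: u_def)
  ultimately obtain r :: "nat \<Rightarrow> nat" where r: "strict_mono r" "AE \<omega> in M. (\<lambda>n. u (r n) \<omega>) \<longlonglongrightarrow> 0"
    using tendsto_L1_AE_subseq by blast
  from r(2) have "AE \<omega> in M. \<forall>i\<in>I. (\<lambda>n. X i (r n) \<omega>) \<longlonglongrightarrow> Y i \<omega>"
  proof eventually_elim
    case (elim \<omega>)
    show ?case
    proof
      fix i assume "i \<in> I"
      have "v i (r n) \<omega> \<le> u (r n) \<omega>" for n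
        unfolding u_def using \<open>finite I\<close> \<open>i \<in> I\<close> v01 by (intro member_le_sum) auto
      then have lv: "(\<lambda>n. v i (r n) \<omega>) \<longlonglongrightarrow> 0"
        using elim v01 by (intro tendsto_sandwich[OF _ _ tendsto_const elim]) auto
      then have "\<forall>\<^sub>F n in sequentially. v i (r n) \<omega> < 1"
        by (rule order_tendstoD) simp
      then have "\<forall>\<^sub>F n in sequentially. v i (r n) \<omega> = \<bar>X i (r n) \<omega> - Y i \<omega>\<bar>"
        by eventually_elim (auto simp: v_def)
      with lv have "(\<lambda>n. \<bar>X i (r n) \<omega> - Y i \<omega>\<bar>) \<longlonglongrightarrow> 0"
        using tendsto_cong by fast
      then show "(\<lambda>n. X i (r n) \<omega>) \<longlonglongrightarrow> Y i \<omega>"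
        using tendsto_rabs_zero_cancel LIM_zero_cancel by fast
    qed
  qed
  with r(1) show ?thesis by blast
qed

text \<open>
  Each coarse step consists of \<open>k\<close> fine steps: \<open>l - l mod k\<close> is the coarse node to the left of \<open>l\<close>, and
  \<open>z l\<close> is the increment of the driver over the \<open>l\<close>-th fine step. If the left sums of \<open>u\<close> reproduced
  \<open>u\<close> itself at the coarse nodes, this would be the difference at those nodes between \<open>u\<close> and the
  coarse Euler scheme; they do so only in the limit \<open>k \<rightarrow> \<infinity>\<close>.
\<close>

fun frozen_euler :: "nat \<Rightarrow> (nat \<Rightarrow> real) \<Rightarrow> (nat \<Rightarrow> real) \<Rightarrow> nat \<Rightarrow> real" where
  "frozen_euler k u z 0 = 0"
| "frozen_euler k u z (Suc l) = frozen_euler k u z l +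
     (frozen_euler k u z (l - l mod k) + u l - u (l - l mod k)) * z l"

text \<open>Within one block of \<open>k\<close> fine steps the left coarse node does not move, so
  the recursion only adds increments with a frozen coefficient and can be summed explicitly. This
  exposes the coarse Euler factor, multiplying the old value, and a remainder made of left sums of
  \<open>u\<close>.\<close>

lemma frozen_euler_block:
  assumes "0 < k"
  shows "frozen_euler k u z (k * Suc i) =
    frozen_euler k u z (k * i) * (1 + (\<Sum>j<k. z (k * i + j))) +
    (\<Sum>j<k. (u (k * i + j) - u (k * i)) * z (k * i + j))"
proof -
  \<comment> \<open>In \<open>\<Sum>j<j\<close> the upper limit is the outer \<open>j\<close>, the
    number of fine steps already made inside the block.\<close>
  have "frozen_euler k u z (k * i + j) =
      frozen_euler k u z (k * i) * (1 + (\<Sum>j<j. z (k * i + j))) +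
      (\<Sum>j<j. (u (k * i + j) - u (k * i)) * z (k * i + j))" if "j \<le> k" for j
    using that
  proof (induction j)
    case (Suc j)
    have "k * i + j - (k * i + j) mod k = k * i" using Suc.prems by simp
    with Suc show ?case by (simp add: algebra_simps)
  qed simp
  from this[of k] show ?thesis by (simp add: add.commute)
qed

text \<open>The majorant grows with \<open>l\<close>, so the delayed value \<mu> (c l) may be
  replaced by the majorant at \<open>l\<close> itself, and the usual discrete Gronwall argument
  applies with rate a + 2 b. The forcing 2 b \<eta> is absorbed as \<eta> (a + 2 b), which is what
  produces the closed form with \<open>- 1\<close>.\<close>

lemma delayed_gronwall:
  fixes \<mu> :: "nat \<Rightarrow> real"
  assumes "\<mu> 0 \<le> 0" and nonneg: "0 \<le> a" "0 \<le> b" "0 \<le> \<eta>"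
    and step: "\<And>l. l < L \<Longrightarrow> \<mu> (Suc l) \<le> (1 + a) * \<mu> l + b * (2 * \<mu> (c l) + 2 * \<eta>)"
    and c: "\<And>l. c l \<le> l"
    and "l \<le> L"
  shows "\<mu> l \<le> \<eta> * ((1 + (a + 2 * b)) ^ l - 1)"
  using \<open>l \<le> L\<close>
proof (induction l rule: less_induct)
  case (less l)
  show ?case
  proof (cases l)
    case 0
    then show ?thesis using assms by simp
  next
    case (Suc m)
    define y where "y = (\<lambda>l. (1 + (a + 2 * b)) ^ l - 1)"
    have y: "\<mu> m \<le> \<eta> * y m" "\<mu> (c m) \<le> \<eta> * y (c m)"
      using less.IH[of m] less.IH[of "c m"] less.prems c[of m] Suc by (auto simp: y_def)
    have "y (c m) \<le> y m"
      using power_increasing[OF c[of m], of "1 + (a + 2 * b)"] nonneg by (simp add: y_def)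
    then have y': "\<mu> (c m) \<le> \<eta> * y m"
      using y(2) mult_left_mono[of "y (c m)" "y m" \<eta>] nonneg by linarith
    have "\<mu> (Suc m) \<le> (1 + a) * (\<eta> * y m) + b * (2 * (\<eta> * y m) + 2 * \<eta>)"
    proof -
      have "(1 + a) * \<mu> m \<le> (1 + a) * (\<eta> * y m)"
        "b * (2 * \<mu> (c m) + 2 * \<eta>) \<le> b * (2 * (\<eta> * y m) + 2 * \<eta>)"
        using y(1) y' nonneg by (auto intro!: mult_left_mono)
      with step[of m] less.prems Suc show ?thesis by simp
    qed
    also have "\<dots> = \<eta> * (y m + (a + 2 * b) * y m + 2 * b)"
      by (simp add: algebra_simps)
    also have "\<dots> \<le> \<eta> * (y m + (a + 2 * b) * y m + (a + 2 * b))"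
      using nonneg by (intro mult_left_mono) auto
    also have "\<dots> = \<eta> * y (Suc m)"
      by (simp add: y_def algebra_simps)
    finally show ?thesis by (simp add: Suc y_def)
  qed
qed

text \<open>Each path is uniformly continuous, but with a modulus depending on the path. If the
  claim failed, there would be pairs of times with vanishing distance and L2 gap at least
  \<epsilon>; along a subsequence both members converge to the same time, and dominated convergence,
  with the bound 2 N on the difference, contradicts the gap.\<close>

lemma (in prob_space) uniformly_continuous_in_L2:
  fixes U :: "real \<Rightarrow> 'a \<Rightarrow> real"
  assumes U: "\<And>s. s \<in> {0..t} \<Longrightarrow> U s \<in> borel_measurable M"
    and bound: "\<And>s \<omega>. \<bar>U s \<omega>\<bar> \<le> N"
    and cont: "\<And>\<omega>. \<omega> \<in> space M \<Longrightarrow> continuous_on {0..t} (\<lambda>s. U s \<omega>)"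
    and "0 < \<epsilon>"
  shows "\<exists>\<delta>>0. \<forall>s\<in>{0..t}. \<forall>s'\<in>{0..t}. \<bar>s - s'\<bar> < \<delta> \<longrightarrow> expectation (\<lambda>\<omega>. (U s \<omega> - U s' \<omega>)\<^sup>2) < \<epsilon>"
proof (rule ccontr)
  assume neg: "\<not> ?thesis"
  \<comment> \<open>The two times are packed into a pair so that a single application of choice
    selects both.\<close>
  have "\<forall>n. \<exists>p. fst p \<in> {0..t} \<and> snd p \<in> {0..t} \<and> \<bar>fst p - snd p\<bar> < 1 / real (Suc n) \<and>
      \<epsilon> \<le> expectation (\<lambda>\<omega>. (U (fst p) \<omega> - U (snd p) \<omega>)\<^sup>2)"
  proof
    fix n
    have "0 < 1 / real (Suc n)" by simp
    with neg obtain s s' where "s \<in> {0..t}" "s' \<in> {0..t}" "\<bar>s - s'\<bar> < 1 / real (Suc n)"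
        "\<not> expectation (\<lambda>\<omega>. (U s \<omega> - U s' \<omega>)\<^sup>2) < \<epsilon>"
      by blast
    then show "\<exists>p. fst p \<in> {0..t} \<and> snd p \<in> {0..t} \<and> \<bar>fst p - snd p\<bar> < 1 / real (Suc n) \<and>
        \<epsilon> \<le> expectation (\<lambda>\<omega>. (U (fst p) \<omega> - U (snd p) \<omega>)\<^sup>2)"
      by (intro exI[of _ "(s, s')"]) auto
  qed
  from choice[OF this] obtain p where p: "fst (p n) \<in> {0..t}" "snd (p n) \<in> {0..t}"
      "\<bar>fst (p n) - snd (p n)\<bar> < 1 / real (Suc n)"
      "\<epsilon> \<le> expectation (\<lambda>\<omega>. (U (fst (p n)) \<omega> - U (snd (p n)) \<omega>)\<^sup>2)" for n
    by blast
  have "\<forall>n. (fst \<circ> p) n \<in> {0..t}" using p(1) by simp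
  from seq_compactE[OF compact_imp_seq_compact[OF compact_Icc] this]
  obtain l r where l: "l \<in> {0..t}" and r: "strict_mono r" "((fst \<circ> p) \<circ> r) \<longlonglongrightarrow> l"
    by blast
  have "(\<lambda>n. fst (p n) - snd (p n)) \<longlonglongrightarrow> 0"
    using p(3) by (intro LIMSEQ_norm_0) auto
  then have "(\<lambda>n. fst (p (r n)) - snd (p (r n))) \<longlonglongrightarrow> 0"
    using LIMSEQ_subseq_LIMSEQ[OF _ r(1)] by (force simp: comp_def)
  from tendsto_diff[OF r(2) this] have l': "(\<lambda>n. snd (p (r n))) \<longlonglongrightarrow> l" by (simp add: comp_def)
  have "(\<lambda>n. expectation (\<lambda>\<omega>. (U (fst (p (r n))) \<omega> - U (snd (p (r n))) \<omega>)\<^sup>2)) \<longlonglongrightarrow> expectation (\<lambda>\<omega>. 0)"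
  proof (rule integral_dominated_convergence[where w = "\<lambda>_. (2 * N)\<^sup>2"])
    show "(\<lambda>\<omega>. (U (fst (p (r n))) \<omega> - U (snd (p (r n))) \<omega>)\<^sup>2) \<in> borel_measurable M" for n
      using U[OF p(1)[of "r n"]] U[OF p(2)[of "r n"]] by measurable
    show "AE \<omega> in M. (\<lambda>n. (U (fst (p (r n))) \<omega> - U (snd (p (r n))) \<omega>)\<^sup>2) \<longlonglongrightarrow> 0"
    proof (rule AE_I2)
      fix \<omega> assume "\<omega> \<in> space M"
      note seq = cont[OF this, unfolded continuous_on_sequentially, rule_format, OF l]
      have "(\<lambda>n. U (fst (p (r n))) \<omega>) \<longlonglongrightarrow> U l \<omega>" "(\<lambda>n. U (snd (p (r n))) \<omega>) \<longlonglongrightarrow> U l \<omega>"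
        using seq[of "\<lambda>n. fst (p (r n))"] seq[of "\<lambda>n. snd (p (r n))"] r(2) l' p(1,2)
        by (simp_all add: comp_def)
      from tendsto_power[OF tendsto_diff[OF this], of 2]
      show "(\<lambda>n. (U (fst (p (r n))) \<omega> - U (snd (p (r n))) \<omega>)\<^sup>2) \<longlonglongrightarrow> 0" by simp
    qed
    show "AE \<omega> in M. norm ((U (fst (p (r n))) \<omega> - U (snd (p (r n))) \<omega>)\<^sup>2) \<le> (2 * N)\<^sup>2" for n
    proof (rule AE_I2)
      fix \<omega>
      have "\<bar>U (fst (p (r n))) \<omega> - U (snd (p (r n))) \<omega>\<bar> \<le> \<bar>2 * N\<bar>"
        using bound[of "fst (p (r n))" \<omega>] bound[of "snd (p (r n))" \<omega>] by linarith
      then show "norm ((U (fst (p (r n))) \<omega> - U (snd (p (r n))) \<omega>)\<^sup>2) \<le> (2 * N)\<^sup>2"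
        by (simp add: abs_le_square_iff)
    qed
  qed simp_all
  with p(4) have "\<epsilon> \<le> 0"
    by (intro LIMSEQ_le_const[where X = "\<lambda>n. expectation (\<lambda>\<omega>. (U (fst (p (r n))) \<omega> - U (snd (p (r n))) \<omega>)\<^sup>2)"]) auto
  with \<open>0 < \<epsilon>\<close> show False by simp
qed

context brownian_motion
begin

text \<open>After expanding the square, the centred increment contributes nothing to the cross term,
  which therefore carries only the drift factor \<open>a\<close>. When \<open>a\<close> is of the
  order of the step length, all growth in one step is of that order, which is what Gronwall
  needs.\<close>

lemma euler_step:
  fixes X V :: "'a \<Rightarrow> real" and a b :: real
  assumes st: "0 \<le> s" "s < t"
    and X: "X \<in> borel_measurable (F s)" "integrable M (\<lambda>\<omega>. (X \<omega>)\<^sup>2)"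
    and V: "V \<in> borel_measurable (F s)" "integrable M (\<lambda>\<omega>. (V \<omega>)\<^sup>2)"
  defines "Y \<equiv> \<lambda>\<omega>. X \<omega> + V \<omega> * (a + b * (B t \<omega> - B s \<omega>))"
  shows "Y \<in> borel_measurable (F t)" "integrable M (\<lambda>\<omega>. (Y \<omega>)\<^sup>2)"
    "expectation (\<lambda>\<omega>. (Y \<omega>)\<^sup>2) \<le> (1 + \<bar>a\<bar>) * expectation (\<lambda>\<omega>. (X \<omega>)\<^sup>2) +
       (\<bar>a\<bar> + a\<^sup>2 + b\<^sup>2 * (t - s)) * expectation (\<lambda>\<omega>. (V \<omega>)\<^sup>2)"
proof -
  have [measurable]: "X \<in> borel_measurable (F t)" "V \<in> borel_measurable (F t)"
      "B t \<in> borel_measurable (F t)" "B s \<in> borel_measurable (F t)"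
    using measurable_F_mono[of s t] X V st B_measurable_F by auto
  show "Y \<in> borel_measurable (F t)" unfolding Y_def by measurable
  have XV: "integrable M (\<lambda>\<omega>. X \<omega> * V \<omega>)" "(\<lambda>\<omega>. X \<omega> * V \<omega>) \<in> borel_measurable (F s)"
    using integrable_mult_of_squares[of X M V] X V measurable_F by auto
  have V2: "(\<lambda>\<omega>. (V \<omega>)\<^sup>2) \<in> borel_measurable (F s)" using V by simp
  let ?u = "\<lambda>\<omega>. a + b * (B t \<omega> - B s \<omega>)"
  have A: "integrable M (\<lambda>\<omega>. X \<omega> * V \<omega> * ?u \<omega>)"
      "expectation (\<lambda>\<omega>. X \<omega> * V \<omega> * ?u \<omega>) = expectation (\<lambda>\<omega>. X \<omega> * V \<omega>) * a"
    using increment_mult[OF st XV(2,1), of "\<lambda>x. a + b * x"] increment_affine(1,2)[OF st] by auto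
  have C: "integrable M (\<lambda>\<omega>. (V \<omega>)\<^sup>2 * (?u \<omega>)\<^sup>2)"
      "expectation (\<lambda>\<omega>. (V \<omega>)\<^sup>2 * (?u \<omega>)\<^sup>2) = expectation (\<lambda>\<omega>. (V \<omega>)\<^sup>2) * (a\<^sup>2 + b\<^sup>2 * (t - s))"
    using increment_mult[OF st V2 V(2), of "\<lambda>x. (a + b * x)\<^sup>2"] increment_affine(3,4)[OF st] by auto
  have eq: "(Y \<omega>)\<^sup>2 = ((X \<omega>)\<^sup>2 + 2 * (X \<omega> * V \<omega> * ?u \<omega>)) + (V \<omega>)\<^sup>2 * (?u \<omega>)\<^sup>2" for \<omega>
    by (simp add: Y_def power2_eq_square algebra_simps)
  have A2: "integrable M (\<lambda>\<omega>. 2 * (X \<omega> * V \<omega> * ?u \<omega>))"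
    using A(1) by (rule integrable_mult_right)
  have D: "integrable M (\<lambda>\<omega>. (X \<omega>)\<^sup>2 + 2 * (X \<omega> * V \<omega> * ?u \<omega>))"
    using X(2) A2 by (rule Bochner_Integration.integrable_add)
  show "integrable M (\<lambda>\<omega>. (Y \<omega>)\<^sup>2)"
    unfolding eq using D C(1) by (rule Bochner_Integration.integrable_add)
  have "2 * a * expectation (\<lambda>\<omega>. X \<omega> * V \<omega>) = expectation (\<lambda>\<omega>. 2 * a * (X \<omega> * V \<omega>))"
    by simp
  also have "\<dots> \<le> expectation (\<lambda>\<omega>. \<bar>a\<bar> * ((X \<omega>)\<^sup>2 + (V \<omega>)\<^sup>2))"
  proof (rule integral_mono)
    fix \<omega>
    have "0 \<le> (\<bar>X \<omega>\<bar> - \<bar>V \<omega>\<bar>)\<^sup>2" by simp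
    then have "2 * \<bar>X \<omega> * V \<omega>\<bar> \<le> (X \<omega>)\<^sup>2 + (V \<omega>)\<^sup>2"
      unfolding power2_diff abs_mult power2_abs by linarith
    from mult_left_mono[OF this, of "\<bar>a\<bar>"]
    have "\<bar>2 * a * (X \<omega> * V \<omega>)\<bar> \<le> \<bar>a\<bar> * ((X \<omega>)\<^sup>2 + (V \<omega>)\<^sup>2)"
      by (simp add: abs_mult mult_ac)
    then show "2 * a * (X \<omega> * V \<omega>) \<le> \<bar>a\<bar> * ((X \<omega>)\<^sup>2 + (V \<omega>)\<^sup>2)" by linarith
  qed (use XV X V in \<open>auto intro!: integrable_mult_right\<close>)
  also have "\<dots> = \<bar>a\<bar> * (expectation (\<lambda>\<omega>. (X \<omega>)\<^sup>2) + expectation (\<lambda>\<omega>. (V \<omega>)\<^sup>2))"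
    using X V by simp
  finally have "2 * a * expectation (\<lambda>\<omega>. X \<omega> * V \<omega>) \<le> \<dots>" .
  moreover have "expectation (\<lambda>\<omega>. (Y \<omega>)\<^sup>2) = expectation (\<lambda>\<omega>. (X \<omega>)\<^sup>2) +
      2 * (expectation (\<lambda>\<omega>. X \<omega> * V \<omega>) * a) + expectation (\<lambda>\<omega>. (V \<omega>)\<^sup>2) * (a\<^sup>2 + b\<^sup>2 * (t - s))"
    unfolding eq Bochner_Integration.integral_add[OF D C(1)] Bochner_Integration.integral_add[OF X(2) A2]
      A(2)[symmetric] C(2)[symmetric] by simp
  ultimately show "expectation (\<lambda>\<omega>. (Y \<omega>)\<^sup>2) \<le> (1 + \<bar>a\<bar>) * expectation (\<lambda>\<omega>. (X \<omega>)\<^sup>2) +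
       (\<bar>a\<bar> + a\<^sup>2 + b\<^sup>2 * (t - s)) * expectation (\<lambda>\<omega>. (V \<omega>)\<^sup>2)"
    by (simp add: algebra_simps)
qed

text \<open>One step of the scheme is an Euler step whose coefficient is the value at the coarse
  node plus an increment of \<open>U\<close> with second moment at most \<eta>. Hence the second
  moments satisfy the delayed recursion with rates |a| and \<kappa>, and the resulting bound is
  proportional to \<eta>.\<close>

lemma frozen_euler_moment:
  fixes U :: "nat \<Rightarrow> 'a \<Rightarrow> real" and k :: nat and a b :: real
  assumes "0 < h" "0 \<le> \<eta>"
    and U: "\<And>l. l < L \<Longrightarrow> U l \<in> borel_measurable (F (real l * h))"
      "\<And>l. l < L \<Longrightarrow> integrable M (\<lambda>\<omega>. (U l \<omega>)\<^sup>2)"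
    and diff: "\<And>l. l < L \<Longrightarrow> expectation (\<lambda>\<omega>. (U l \<omega> - U (l - l mod k) \<omega>)\<^sup>2) \<le> \<eta>"
  defines "X \<equiv> \<lambda>l \<omega>. frozen_euler k (\<lambda>l. U l \<omega>)
      (\<lambda>l. a + b * (B (real (Suc l) * h) \<omega> - B (real l * h) \<omega>)) l"
    and "\<kappa> \<equiv> \<bar>a\<bar> + a\<^sup>2 + b\<^sup>2 * h"
  assumes "l \<le> L"
  shows "X l \<in> borel_measurable (F (real l * h)) \<and> integrable M (\<lambda>\<omega>. (X l \<omega>)\<^sup>2) \<and>
     expectation (\<lambda>\<omega>. (X l \<omega>)\<^sup>2) \<le> \<eta> * ((1 + (\<bar>a\<bar> + 2 * \<kappa>)) ^ l - 1)"
proof -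
  define c where "c = (\<lambda>l. l - l mod k)"
  define V where "V = (\<lambda>l \<omega>. X (c l) \<omega> + (U l \<omega> - U (c l) \<omega>))"
  have X0: "X 0 = (\<lambda>\<omega>. 0)" by (simp add: X_def)
  have XS: "X (Suc l) = (\<lambda>\<omega>. X l \<omega> + V l \<omega> * (a + b * (B (real (Suc l) * h) \<omega> - B (real l * h) \<omega>)))" for l
    by (simp add: X_def V_def c_def algebra_simps)
  have c: "c l \<le> l" for l by (simp add: c_def)
  have lt: "0 \<le> real l * h" "real l * h < real (Suc l) * h" "real (Suc l) * h - real l * h = h" for l
    using \<open>0 < h\<close> by (auto simp: algebra_simps)
  have mono: "real l * h \<le> real m * h" if "l \<le> m" for l m
    using that \<open>0 < h\<close> by (intro mult_right_mono) auto
  have sq: "(x + (y - z))\<^sup>2 \<le> 2 * x\<^sup>2 + 2 * (y - z)\<^sup>2" for x y z :: real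
  proof -
    have "0 \<le> (x - (y - z))\<^sup>2" by simp
    then show ?thesis unfolding power2_diff[of x] power2_sum by linarith
  qed
  have V: "V l \<in> borel_measurable (F (real l * h)) \<and> integrable M (\<lambda>\<omega>. (V l \<omega>)\<^sup>2) \<and>
      expectation (\<lambda>\<omega>. (V l \<omega>)\<^sup>2) \<le> 2 * expectation (\<lambda>\<omega>. (X (c l) \<omega>)\<^sup>2) + 2 * \<eta>"
    if "l < L" and X: "X (c l) \<in> borel_measurable (F (real (c l) * h))" "integrable M (\<lambda>\<omega>. (X (c l) \<omega>)\<^sup>2)" for l
  proof -
    have cL: "c l < L" using c[of l] \<open>l < L\<close> by simp
    have [measurable]: "X (c l) \<in> borel_measurable (F (real l * h))" "U (c l) \<in> borel_measurable (F (real l * h))"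
        "U l \<in> borel_measurable (F (real l * h))"
      using measurable_F_mono[OF mono[OF c[of l]]] X(1) U(1)[OF cL] U(1)[OF \<open>l < L\<close>] by blast+
    have m: "V l \<in> borel_measurable (F (real l * h))" unfolding V_def by measurable
    have "integrable M (\<lambda>\<omega>. (U l \<omega>)\<^sup>2 + (U (c l) \<omega>)\<^sup>2 - 2 * (U l \<omega> * U (c l) \<omega>))"
      using U(2)[OF cL] U(2)[OF \<open>l < L\<close>] measurable_F[OF U(1)[OF cL]] measurable_F[OF U(1)[OF \<open>l < L\<close>]]
      by (intro Bochner_Integration.integrable_add Bochner_Integration.integrable_diff integrable_mult_right
          integrable_mult_of_squares)
    then have Ui: "integrable M (\<lambda>\<omega>. (U l \<omega> - U (c l) \<omega>)\<^sup>2)"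
      by (simp add: power2_diff mult.assoc)
    have i: "integrable M (\<lambda>\<omega>. 2 * (X (c l) \<omega>)\<^sup>2 + 2 * (U l \<omega> - U (c l) \<omega>)\<^sup>2)"
      using X(2) Ui by (intro Bochner_Integration.integrable_add integrable_mult_right)
    have Vi: "integrable M (\<lambda>\<omega>. (V l \<omega>)\<^sup>2)"
    proof (rule Bochner_Integration.integrable_bound[OF i])
      show "(\<lambda>\<omega>. (V l \<omega>)\<^sup>2) \<in> borel_measurable M"
        using measurable_F[OF m] by measurable
    qed (use sq in \<open>auto simp: V_def\<close>)
    have "expectation (\<lambda>\<omega>. (V l \<omega>)\<^sup>2) \<le> expectation (\<lambda>\<omega>. 2 * (X (c l) \<omega>)\<^sup>2 + 2 * (U l \<omega> - U (c l) \<omega>)\<^sup>2)"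
      using Vi i by (rule integral_mono) (simp add: V_def sq)
    also have "\<dots> = 2 * expectation (\<lambda>\<omega>. (X (c l) \<omega>)\<^sup>2) + 2 * expectation (\<lambda>\<omega>. (U l \<omega> - U (c l) \<omega>)\<^sup>2)"
      using X(2) Ui by (subst Bochner_Integration.integral_add) (auto intro!: integrable_mult_right)
    also have "\<dots> \<le> 2 * expectation (\<lambda>\<omega>. (X (c l) \<omega>)\<^sup>2) + 2 * \<eta>"
      using diff[OF \<open>l < L\<close>] by (simp add: c_def)
    finally show ?thesis using m Vi by blast
  qed
  \<comment> \<open>Strong induction, since a step refers back to the coarse node \<open>c m\<close>
    as well as to \<open>m\<close>.\<close>
  have X: "X l \<in> borel_measurable (F (real l * h)) \<and> integrable M (\<lambda>\<omega>. (X l \<omega>)\<^sup>2)" if "l \<le> L" for l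
    using that
  proof (induction l rule: less_induct)
    case (less l)
    show ?case
    proof (cases l)
      case 0
      then show ?thesis by (simp add: X0)
    next
      case (Suc m)
      have cm: "c m < l" "c m \<le> L" using c[of m] less.prems Suc by auto
      have "V m \<in> borel_measurable (F (real m * h))" "integrable M (\<lambda>\<omega>. (V m \<omega>)\<^sup>2)"
        using V[of m] less.IH[OF cm] less.prems Suc by auto
      with euler_step(1,2)[OF lt(1,2)[of m], of "X m" "V m" a b] less.IH[of m] less.prems Suc
      show ?thesis by (simp add: XS)
    qed
  qed
  have "expectation (\<lambda>\<omega>. (X l \<omega>)\<^sup>2) \<le> \<eta> * ((1 + (\<bar>a\<bar> + 2 * \<kappa>)) ^ l - 1)"
  proof (rule delayed_gronwall[where L = L and c = c])
    show "expectation (\<lambda>\<omega>. (X 0 \<omega>)\<^sup>2) \<le> 0" by (simp add: X0)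
    show "0 \<le> \<bar>a\<bar>" "0 \<le> \<kappa>" using \<open>0 < h\<close> by (auto simp: \<kappa>_def)
    show "expectation (\<lambda>\<omega>. (X (Suc l) \<omega>)\<^sup>2) \<le> (1 + \<bar>a\<bar>) * expectation (\<lambda>\<omega>. (X l \<omega>)\<^sup>2) +
        \<kappa> * (2 * expectation (\<lambda>\<omega>. (X (c l) \<omega>)\<^sup>2) + 2 * \<eta>)" if "l < L" for l
    proof -
      have cl: "c l \<le> L" using c[of l] that by simp
      note V' = V[OF that conjunct1[OF X[OF cl]] conjunct2[OF X[OF cl]]]
      have "expectation (\<lambda>\<omega>. (X (Suc l) \<omega>)\<^sup>2) \<le> (1 + \<bar>a\<bar>) * expectation (\<lambda>\<omega>. (X l \<omega>)\<^sup>2) +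
          \<kappa> * expectation (\<lambda>\<omega>. (V l \<omega>)\<^sup>2)"
        using euler_step(3)[OF lt(1,2)[of l], of "X l" "V l" a b] X[of l] V' that
        by (simp add: XS lt(3) \<kappa>_def del: of_nat_Suc)
      also have "\<kappa> * expectation (\<lambda>\<omega>. (V l \<omega>)\<^sup>2) \<le>
          \<kappa> * (2 * expectation (\<lambda>\<omega>. (X (c l) \<omega>)\<^sup>2) + 2 * \<eta>)"
        using V' \<open>0 \<le> \<kappa>\<close> by (intro mult_left_mono) auto
      finally show ?thesis by simp
    qed
  qed (use c \<open>l \<le> L\<close> \<open>0 \<le> \<eta>\<close> in auto)
  with X[OF \<open>l \<le> L\<close>] show ?thesis by blast
qed

text \<open>The exponential also factors over the grid, so the expanded square consists of three
  products of functions of independent increments, and each expectation is an explicit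
  \<open>n\<close>-th power. All three powers tend to exp ((2 g + \<sigma>^2) t), and the
  coefficients 1, -2, 1 cancel.\<close>

lemma euler_product_tendsto:
  assumes "0 < t"
  shows "(\<lambda>n. expectation (\<lambda>\<omega>. ((\<Prod>i<n. 1 + g * (t / real n) +
        \<sigma> * (B (real (Suc i) * (t / real n)) \<omega> - B (real i * (t / real n)) \<omega>)) -
      exp (\<sigma> * B t \<omega> + (g - \<sigma>\<^sup>2 / 2) * t))\<^sup>2)) \<longlonglongrightarrow> 0"
    "0 < n \<Longrightarrow> integrable M (\<lambda>\<omega>. ((\<Prod>i<n. 1 + g * (t / real n) +
        \<sigma> * (B (real (Suc i) * (t / real n)) \<omega> - B (real i * (t / real n)) \<omega>)) -
      exp (\<sigma> * B t \<omega> + (g - \<sigma>\<^sup>2 / 2) * t))\<^sup>2)"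
proof -
  define D where "D = (\<lambda>n \<omega>. ((\<Prod>i<n. 1 + g * (t / real n) +
        \<sigma> * (B (real (Suc i) * (t / real n)) \<omega> - B (real i * (t / real n)) \<omega>)) -
      exp (\<sigma> * B t \<omega> + (g - \<sigma>\<^sup>2 / 2) * t))\<^sup>2)"
  have *: "integrable M (D n) \<and> expectation (D n) = ((1 + g * (t / real n))\<^sup>2 + \<sigma>\<^sup>2 * (t / real n)) ^ n -
      2 * ((1 + g * (t / real n) + \<sigma>\<^sup>2 * (t / real n)) * exp (g * (t / real n))) ^ n +
      exp ((2 * g + \<sigma>\<^sup>2) * (t / real n)) ^ n" if "0 < n" for n
  proof -
    define h where "h = t / real n"
    have h: "0 < h" "real n * h = t" using that assms by (auto simp: h_def)
    define W where "W = (\<lambda>i \<omega>. B (real (Suc i) * h) \<omega> - B (real i * h) \<omega>)"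
    \<comment> \<open>With p the one-step Euler factor and q the one-step exponential, these are
      p^2, p q and q^2 as functions of the increment. The mixed one is written through exp (\<sigma>
      x) and x exp (\<sigma> x), whose expectations are known.\<close>
    define u1 where "u1 = (\<lambda>x. ((1 + g * h) + \<sigma> * x)\<^sup>2)"
    define u2 where "u2 = (\<lambda>x. exp ((g - \<sigma>\<^sup>2 / 2) * h) * ((1 + g * h) * exp (\<sigma> * x) + \<sigma> * (x * exp (\<sigma> * x))))"
    define u3 where "u3 = (\<lambda>x. exp (2 * (g - \<sigma>\<^sup>2 / 2) * h) * exp (2 * \<sigma> * x))"
    have [measurable]: "u1 \<in> borel_measurable borel" "u2 \<in> borel_measurable borel" "u3 \<in> borel_measurable borel"
      unfolding u1_def u2_def u3_def by measurable
    have b: "exp (\<sigma> * B t \<omega> + (g - \<sigma>\<^sup>2 / 2) * t) = (\<Prod>i<n. exp (\<sigma> * W i \<omega> + (g - \<sigma>\<^sup>2 / 2) * h))"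
      if "\<omega> \<in> space M" for \<omega>
    proof -
      have "(\<Sum>i<n. W i \<omega>) = B t \<omega>"
        unfolding W_def using sum_lessThan_telescope[of "\<lambda>i. B (real i * h) \<omega>" n] B_0[OF that] h by simp
      then have "(\<Sum>i<n. \<sigma> * W i \<omega> + (g - \<sigma>\<^sup>2 / 2) * h) = \<sigma> * B t \<omega> + (g - \<sigma>\<^sup>2 / 2) * t"
        using h unfolding sum.distrib sum_distrib_left[symmetric] by simp
      then show ?thesis by (simp add: exp_sum[symmetric])
    qed
    let ?R = "\<lambda>u \<omega>. (\<Prod>i<n. u (W i \<omega>) :: real)"
    have D: "D n \<omega> = ?R u1 \<omega> - 2 * ?R u2 \<omega> + ?R u3 \<omega>" if "\<omega> \<in> space M" for \<omega>
    proof -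
      define p q where "p = (\<lambda>i. 1 + g * h + \<sigma> * W i \<omega>)"
        and "q = (\<lambda>i. exp (\<sigma> * W i \<omega> + (g - \<sigma>\<^sup>2 / 2) * h))"
      have "u1 (W i \<omega>) = p i * p i" "u2 (W i \<omega>) = p i * q i" "u3 (W i \<omega>) = q i * q i" for i
        by (simp_all add: u1_def u2_def u3_def p_def q_def power2_eq_square exp_add ring_distribs)
          (simp add: exp_add[symmetric])
      then have "?R u1 \<omega> - 2 * ?R u2 \<omega> + ?R u3 \<omega> = (prod p {..<n} - prod q {..<n})\<^sup>2"
        by (simp add: prod.distrib power2_eq_square algebra_simps)
      then show ?thesis
        unfolding D_def b[OF that] h_def[symmetric] p_def q_def by (simp add: W_def)
    qed
    have st: "s < s + h" "s + h - s = h" for s using h by auto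
    have R1: "integrable M (?R u1)" "expectation (?R u1) = ((1 + g * h)\<^sup>2 + \<sigma>\<^sup>2 * h) ^ n"
      unfolding W_def
      using expectation_prod_increments[of u1 h, where n = n] increment_affine(3,4)[OF _ st(1), where a = "1 + g * h" and b = \<sigma>] h
      by (auto simp: u1_def)
    have i2: "integrable M (\<lambda>\<omega>. u2 (B (s + h) \<omega> - B s \<omega>))"
      "expectation (\<lambda>\<omega>. u2 (B (s + h) \<omega> - B s \<omega>)) = (1 + g * h + \<sigma>\<^sup>2 * h) * exp (g * h)" if "0 \<le> s" for s
    proof -
      note e = increment_exp[OF that st(1), of \<sigma>]
      show "integrable M (\<lambda>\<omega>. u2 (B (s + h) \<omega> - B s \<omega>))"
        unfolding u2_def using e by (intro integrable_mult_right Bochner_Integration.integrable_add) 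
      have "expectation (\<lambda>\<omega>. u2 (B (s + h) \<omega> - B s \<omega>)) = exp ((g - \<sigma>\<^sup>2 / 2) * h) *
          ((1 + g * h) * exp (\<sigma>\<^sup>2 * h / 2) + \<sigma> * (\<sigma> * h * exp (\<sigma>\<^sup>2 * h / 2)))"
        unfolding u2_def using e by (simp add: st(2))
      also have "\<dots> = (1 + g * h + \<sigma>\<^sup>2 * h) * (exp ((g - \<sigma>\<^sup>2 / 2) * h) * exp (\<sigma>\<^sup>2 * h / 2))"
        by (simp add: power2_eq_square algebra_simps)
      also have "exp ((g - \<sigma>\<^sup>2 / 2) * h) * exp (\<sigma>\<^sup>2 * h / 2) = exp (g * h)"
        by (simp add: exp_add[symmetric] algebra_simps)
      finally show "expectation (\<lambda>\<omega>. u2 (B (s + h) \<omega> - B s \<omega>)) = (1 + g * h + \<sigma>\<^sup>2 * h) * exp (g * h)" .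
    qed
    have R2: "integrable M (?R u2)" "expectation (?R u2) = ((1 + g * h + \<sigma>\<^sup>2 * h) * exp (g * h)) ^ n"
      unfolding W_def using expectation_prod_increments[of u2 h, where n = n, OF _ h(1) i2] by auto
    have i3: "integrable M (\<lambda>\<omega>. u3 (B (s + h) \<omega> - B s \<omega>))"
      "expectation (\<lambda>\<omega>. u3 (B (s + h) \<omega> - B s \<omega>)) = exp ((2 * g + \<sigma>\<^sup>2) * h)" if "0 \<le> s" for s
    proof -
      note e = increment_exp(1,2)[OF that st(1), of "2 * \<sigma>"]
      show "integrable M (\<lambda>\<omega>. u3 (B (s + h) \<omega> - B s \<omega>))"
        unfolding u3_def using e(1) by (rule integrable_mult_right)
      show "expectation (\<lambda>\<omega>. u3 (B (s + h) \<omega> - B s \<omega>)) = exp ((2 * g + \<sigma>\<^sup>2) * h)"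
        unfolding u3_def integral_mult_right_zero e(2) st(2)
        by (simp add: exp_add[symmetric]) (simp add: power2_eq_square algebra_simps)
    qed
    have R3: "integrable M (?R u3)" "expectation (?R u3) = exp ((2 * g + \<sigma>\<^sup>2) * h) ^ n"
      unfolding W_def using expectation_prod_increments[of u3 h, where n = n, OF _ h(1) i3] by auto
    have "integrable M (\<lambda>\<omega>. ?R u1 \<omega> - 2 * ?R u2 \<omega> + ?R u3 \<omega>)"
      using R1(1) R2(1) R3(1) by auto
    moreover have "expectation (\<lambda>\<omega>. ?R u1 \<omega> - 2 * ?R u2 \<omega> + ?R u3 \<omega>) =
        ((1 + g * h)\<^sup>2 + \<sigma>\<^sup>2 * h) ^ n - 2 * ((1 + g * h + \<sigma>\<^sup>2 * h) * exp (g * h)) ^ n + exp ((2 * g + \<sigma>\<^sup>2) * h) ^ n"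
      using R1 R2 R3 by simp
    ultimately show ?thesis
      using D by (simp add: h_def[symmetric] cong: Bochner_Integration.integrable_cong Bochner_Integration.integral_cong)
  qed
  show "0 < n \<Longrightarrow> integrable M (\<lambda>\<omega>. ((\<Prod>i<n. 1 + g * (t / real n) +
        \<sigma> * (B (real (Suc i) * (t / real n)) \<omega> - B (real i * (t / real n)) \<omega>)) -
      exp (\<sigma> * B t \<omega> + (g - \<sigma>\<^sup>2 / 2) * t))\<^sup>2)"
    using * unfolding D_def by blast
  have "(\<lambda>n. ((1 + g * (t / real n))\<^sup>2 + \<sigma>\<^sup>2 * (t / real n)) ^ n) \<longlonglongrightarrow> exp ((2 * g + \<sigma>\<^sup>2) * t)"
    using \<open>0 < t\<close> by (real_asymp simp: algebra_simps)
  moreover have "(\<lambda>n. ((1 + g * (t / real n) + \<sigma>\<^sup>2 * (t / real n)) * exp (g * (t / real n))) ^ n) \<longlonglongrightarrow>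
      exp ((2 * g + \<sigma>\<^sup>2) * t)"
    using \<open>0 < t\<close> by (real_asymp simp: algebra_simps)
  moreover have "(\<lambda>n. exp ((2 * g + \<sigma>\<^sup>2) * (t / real n)) ^ n) \<longlonglongrightarrow> exp ((2 * g + \<sigma>\<^sup>2) * t)"
    using \<open>0 < t\<close> by (real_asymp simp: algebra_simps)
  ultimately have "(\<lambda>n. ((1 + g * (t / real n))\<^sup>2 + \<sigma>\<^sup>2 * (t / real n)) ^ n -
      2 * ((1 + g * (t / real n) + \<sigma>\<^sup>2 * (t / real n)) * exp (g * (t / real n))) ^ n +
      exp ((2 * g + \<sigma>\<^sup>2) * (t / real n)) ^ n) \<longlonglongrightarrow> exp ((2 * g + \<sigma>\<^sup>2) * t) - 2 * exp ((2 * g + \<sigma>\<^sup>2) * t) + exp ((2 * g + \<sigma>\<^sup>2) * t)"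
    by (intro tendsto_intros)
  \<comment> \<open>The closed formula holds for positive \<open>n\<close>, hence only eventually;
    the limit, of the form x - 2 x + x, is rewritten to 0.\<close>
  then have "(\<lambda>n. expectation (D n)) \<longlonglongrightarrow> 0"
    by (rule Lim_transform_eventually[THEN back_subst[of "\<lambda>x. _ \<longlonglongrightarrow> x"]])
      (use * in \<open>auto simp: eventually_sequentially intro!: exI[of _ 1]\<close>)
  then show "(\<lambda>n. expectation (\<lambda>\<omega>. ((\<Prod>i<n. 1 + g * (t / real n) +
        \<sigma> * (B (real (Suc i) * (t / real n)) \<omega> - B (real i * (t / real n)) \<omega>)) -
      exp (\<sigma> * B t \<omega> + (g - \<sigma>\<^sup>2 / 2) * t))\<^sup>2)) \<longlonglongrightarrow> 0"
    unfolding D_def .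
qed

end

subsection \<open>The explicit price process\<close>

lemma sum_lessThan_add: "(\<Sum>l<a + b. f l) = (\<Sum>l<a. f l) + (\<Sum>j<b. f (a + j :: nat) :: real)"
  by (induction b) simp_all

context brownian_motion
begin

text \<open>The stochastic integral up to the node i t / n is determined by uniform partitions of
  that interval. Using \<open>Suc k * i\<close> cells for the \<open>i\<close>-th node gives the
  same mesh \<open>h k\<close> for all \<open>i\<close>, so all these partitions are initial pieces
  of one grid with \<open>Suc k\<close> fine steps per Euler step. The drift and the stochastic left
  sums then merge into a single sum against g h + \<sigma> dB.\<close>

lemma price_left_sums_AE_subseq:
  assumes P: "price_process M F B g \<sigma> P0 P" and "0 < t" "0 < n"
  defines "h \<equiv> \<lambda>k. t / (real n * real (Suc k))"
  shows "\<exists>r::nat\<Rightarrow>nat. strict_mono r \<and> (AE \<omega> in M. \<forall>i\<le>n.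
     (\<lambda>m. \<Sum>l<Suc (r m) * i. P (real l * h (r m)) \<omega> * (g * h (r m) +
        \<sigma> * (B (real (Suc l) * h (r m)) \<omega> - B (real l * h (r m)) \<omega>)))
      \<longlonglongrightarrow> P (real i * (t / real n)) \<omega> - P0)"
proof -
  define \<tau> where "\<tau> = (\<lambda>i. real i * (t / real n))"
  have \<tau>: "0 \<le> \<tau> i" for i using assms by (simp add: \<tau>_def)
  \<comment> \<open>The nodes and the mesh of the partition of \<open>[0, \<tau> i]\<close> agree
    with those of the common grid; i = 0, where the interval degenerates, is treated apart.\<close>
  have hk: "\<tau> i * real l / real (Suc k * i) = real l * h k" "\<tau> i / real (Suc k * i) = h k" if "0 < i" for i l k
  proof -
    have "x * (t / y) * v / (c * x) = v * (t / (y * c))" "x * (t / y) / (c * x) = t / (y * c)"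
      if "0 < x" "0 < y" "0 < c" for x y c v :: real
      using that by (simp_all add: field_simps)
    with that \<open>0 < n\<close> show "\<tau> i * real l / real (Suc k * i) = real l * h k" "\<tau> i / real (Suc k * i) = h k"
      unfolding \<tau>_def h_def of_nat_mult by auto
  qed
  have P_cont: "\<And>\<omega>. \<omega> \<in> space M \<Longrightarrow> continuous_on {0..} (\<lambda>s. P s \<omega>)"
    and P_0: "\<And>\<omega>. \<omega> \<in> space M \<Longrightarrow> P 0 \<omega> = P0"
    and P_ad: "\<And>s. 0 \<le> s \<Longrightarrow> P s \<in> borel_measurable (F s)"
    using P unfolding price_process_def continuous_adapted_def by auto
  have "\<forall>i. \<exists>I. has_ito_integral M F B (\<lambda>s \<omega>. \<sigma> * P s \<omega>) (\<tau> i) I \<and>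
        (AE \<omega> in M. P (\<tau> i) \<omega> = P0 + integral {0..\<tau> i} (\<lambda>s. g * P s \<omega>) + I \<omega>)"
    using P \<tau> unfolding price_process_def by blast
  from choice[OF this] obtain I where
    I: "\<And>i. has_ito_integral M F B (\<lambda>s \<omega>. \<sigma> * P s \<omega>) (\<tau> i) (I i)"
    and P_eq: "\<And>i. AE \<omega> in M. P (\<tau> i) \<omega> = P0 + integral {0..\<tau> i} (\<lambda>s. g * P s \<omega>) + I i \<omega>"
    by blast
  define X where "X = (\<lambda>i k \<omega>. \<Sum>l<Suc k * i. \<sigma> * P (real l * h k) \<omega> *
      (B (real (Suc l) * h k) \<omega> - B (real l * h k) \<omega>))"
  have lim: "tendsto_in_prob M (X i) (I i)" if "i \<in> {1..n}" for i
    unfolding tendsto_in_prob_def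
  proof (intro allI impI)
    fix \<epsilon> :: real assume "0 < \<epsilon>"
    have i: "0 < i" using that by simp
    \<comment> \<open>The cell counts \<open>Suc k * i\<close> form a subsequence of all cell
      counts, so the limit in probability is inherited.\<close>
    have "strict_mono (\<lambda>k. Suc k * i)"
      using i by (intro strict_monoI) simp
    from LIMSEQ_subseq_LIMSEQ[OF _ this] I[of i] \<open>0 < \<epsilon>\<close>
    have "(\<lambda>k. prob {\<omega> \<in> space M. \<epsilon> < \<bar>(\<Sum>l<Suc k * i. \<sigma> * P (\<tau> i * real l / real (Suc k * i)) \<omega> *
        (B (\<tau> i * real (Suc l) / real (Suc k * i)) \<omega> - B (\<tau> i * real l / real (Suc k * i)) \<omega>)) - I i \<omega>\<bar>})
      \<longlonglongrightarrow> 0"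
      unfolding has_ito_integral_def tendsto_in_prob_def comp_def by blast
    then show "(\<lambda>k. prob {\<omega> \<in> space M. \<epsilon> < \<bar>X i k \<omega> - I i \<omega>\<bar>}) \<longlonglongrightarrow> 0"
      unfolding hk[OF i] X_def .
  qed
  have "0 \<le> h k" for k using assms by (simp add: h_def)
  then have "P (real l * h k) \<in> borel_measurable M" "B (real l * h k) \<in> borel_measurable M" for l k
    using measurable_F[OF P_ad] B_measurable by simp_all
  then have "X i k \<in> borel_measurable M" for i k
    unfolding X_def
    by (intro borel_measurable_sum borel_measurable_times borel_measurable_diff borel_measurable_const)
  moreover have "I i \<in> borel_measurable M" for i
    using I[of i] unfolding has_ito_integral_def by blast
  ultimately obtain r :: "nat \<Rightarrow> nat" where r: "strict_mono r"
    and X_lim: "AE \<omega> in M. \<forall>i\<in>{1..n}. (\<lambda>m. X i (r m) \<omega>) \<longlonglongrightarrow> I i \<omega>"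
    using tendsto_in_prob_AE_subseq[of "{1..n}" X I] lim by blast
  have "AE \<omega> in M. \<forall>i. P (\<tau> i) \<omega> = P0 + integral {0..\<tau> i} (\<lambda>s. g * P s \<omega>) + I i \<omega>"
    using P_eq by (simp add: AE_all_countable)
  with X_lim AE_space have "AE \<omega> in M. \<forall>i\<le>n.
     (\<lambda>m. \<Sum>l<Suc (r m) * i. P (real l * h (r m)) \<omega> * (g * h (r m) +
        \<sigma> * (B (real (Suc l) * h (r m)) \<omega> - B (real l * h (r m)) \<omega>)))
      \<longlonglongrightarrow> P (\<tau> i) \<omega> - P0"
  proof eventually_elim
    case (elim \<omega>)
    show ?case
    proof (intro allI impI)
      fix i assume "i \<le> n"
      show "(\<lambda>m. \<Sum>l<Suc (r m) * i. P (real l * h (r m)) \<omega> * (g * h (r m) +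
          \<sigma> * (B (real (Suc l) * h (r m)) \<omega> - B (real l * h (r m)) \<omega>)))
        \<longlonglongrightarrow> P (\<tau> i) \<omega> - P0"
      proof (cases "i = 0")
        case True
        then show ?thesis using P_0 elim by (simp add: \<tau>_def)
      next
        case False
        then have i: "0 < i" "i \<in> {1..n}" using \<open>i \<le> n\<close> by auto
        have "strict_mono (\<lambda>m. Suc (r m) * i)"
          using i strict_monoD[OF r] by (intro strict_monoI) simp
        moreover have "continuous_on {0..\<tau> i} (\<lambda>s. g * P s \<omega>)"
          using elim by (intro continuous_intros continuous_on_subset[OF P_cont]) auto
        ultimately have "(\<lambda>m. \<Sum>l<Suc (r m) * i. g * P (\<tau> i * real l / real (Suc (r m) * i)) \<omega> *
            (\<tau> i / real (Suc (r m) * i))) \<longlonglongrightarrow> integral {0..\<tau> i} (\<lambda>s. g * P s \<omega>)"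
          using LIMSEQ_subseq_LIMSEQ[OF left_sums_tendsto_integral] \<tau>[of i] unfolding comp_def by blast
        then have "(\<lambda>m. (\<Sum>l<Suc (r m) * i. g * P (real l * h (r m)) \<omega> * h (r m)) + X i (r m) \<omega>)
            \<longlonglongrightarrow> integral {0..\<tau> i} (\<lambda>s. g * P s \<omega>) + I i \<omega>"
          unfolding hk[OF i(1)] using elim(1) i(2) by (intro tendsto_add) auto
        moreover have "P (\<tau> i) \<omega> - P0 = integral {0..\<tau> i} (\<lambda>s. g * P s \<omega>) + I i \<omega>"
          using elim by simp
        ultimately show ?thesis
          unfolding X_def sum.distrib[symmetric] by (simp add: algebra_simps)
      qed
    qed
  qed
  with r show ?thesis unfolding \<tau>_def by blast
qed

text \<open>
  The function \<open>f\<close> replaces the product of \<open>(P t - P0 * Q n)\<^sup>2\<close> with the indicator of the event that the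
  path stays below \<open>N\<close>, which would have to be shown measurable.
\<close>

lemma euler_error:
  fixes N :: real and P :: "real \<Rightarrow> 'a \<Rightarrow> real"
  assumes P: "price_process M F B g \<sigma> P0 P" and "0 < t" "0 < n" "0 \<le> N"
  defines "U \<equiv> \<lambda>s \<omega>. max (- N) (min N (P s \<omega>))"
    and "Q \<equiv> \<lambda>n \<omega>. \<Prod>i<n. 1 + g * (t / real n) +
        \<sigma> * (B (real (Suc i) * (t / real n)) \<omega> - B (real i * (t / real n)) \<omega>)"
  shows "\<exists>f\<in>borel_measurable M.
    (\<forall>\<eta>\<ge>0. (\<forall>s\<in>{0..t}. \<forall>s'\<in>{0..t}. \<bar>s - s'\<bar> \<le> t / real n \<longrightarrow> expectation (\<lambda>\<omega>. (U s \<omega> - U s' \<omega>)\<^sup>2) \<le> \<eta>) \<longrightarrow>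
        (\<integral>\<^sup>+\<omega>. f \<omega> \<partial>M) \<le> ennreal (\<eta> * exp (t * (3 * \<bar>g\<bar> + 2 * g\<^sup>2 * t + 2 * \<sigma>\<^sup>2)))) \<and>
    (AE \<omega> in M. (\<forall>s\<in>{0..t}. \<bar>P s \<omega>\<bar> \<le> N) \<longrightarrow> f \<omega> = ennreal ((P t \<omega> - P0 * Q n \<omega>)\<^sup>2))"
proof -
  define h where "h = (\<lambda>k. t / (real n * real (Suc k)))"
  have h: "0 < h k" "h k \<le> t" "real (Suc k * n) * h k = t" "real (Suc k) * h k = t / real n" for k
  proof -
    show "0 < h k" "real (Suc k * n) * h k = t" "real (Suc k) * h k = t / real n"
      using \<open>0 < t\<close> \<open>0 < n\<close> unfolding h_def of_nat_mult by simp_all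
    have "1 \<le> real n * real (Suc k)" using \<open>0 < n\<close>
      by (metis One_nat_def Suc_leI mult_le_mono nat_mult_1 of_nat_1 of_nat_le_iff of_nat_mult zero_less_Suc)
    then show "h k \<le> t" using \<open>0 < t\<close> by (simp add: h_def divide_le_eq)
  qed
  define z where "z = (\<lambda>k \<omega> l. g * h k + \<sigma> * (B (real (Suc l) * h k) \<omega> - B (real l * h k) \<omega>))"
  define X where "X = (\<lambda>k \<omega>. frozen_euler (Suc k) (\<lambda>l. U (real l * h k) \<omega>) (z k \<omega>))"
  have P_ad: "\<And>s. 0 \<le> s \<Longrightarrow> P s \<in> borel_measurable (F s)"
    and P_0: "\<And>\<omega>. \<omega> \<in> space M \<Longrightarrow> P 0 \<omega> = P0"
    using P unfolding price_process_def continuous_adapted_def by auto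
  have U_m: "U s \<in> borel_measurable (F s)" if "0 \<le> s" for s
    unfolding U_def using P_ad[OF that] by measurable
  have U_b: "\<bar>U s \<omega>\<bar> \<le> N" for s \<omega> using \<open>0 \<le> N\<close> by (auto simp: U_def)
  have U_i: "integrable M (\<lambda>\<omega>. (U s \<omega>)\<^sup>2)" if "0 \<le> s" for s
  proof (rule integrable_const_bound[where B = "N\<^sup>2"])
    show "AE \<omega> in M. norm ((U s \<omega>)\<^sup>2) \<le> N\<^sup>2"
      using U_b[of s] \<open>0 \<le> N\<close> by (intro AE_I2) (simp add: abs_le_square_iff[symmetric])
  qed (use measurable_F[OF U_m[OF that]] in measurable)
  obtain r :: "nat \<Rightarrow> nat" where r: "strict_mono r" and
    lim: "AE \<omega> in M. \<forall>i\<le>n. (\<lambda>m. \<Sum>l<Suc (r m) * i. P (real l * h (r m)) \<omega> * z (r m) \<omega> l)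
      \<longlonglongrightarrow> P (real i * (t / real n)) \<omega> - P0"
    using price_left_sums_AE_subseq[OF P \<open>0 < t\<close> \<open>0 < n\<close>] unfolding h_def z_def by blast
  \<comment> \<open>The lower limit is defined and measurable on all paths, whether or not the
    scheme converges there, and Fatou's lemma carries the uniform moment bounds over to it.\<close>
  define f where "f = (\<lambda>\<omega>. liminf (\<lambda>m. ennreal ((X (r m) \<omega> (Suc (r m) * n))\<^sup>2)))"
  have X_mom: "(\<lambda>\<omega>. X k \<omega> (Suc k * n)) \<in> borel_measurable M \<and> integrable M (\<lambda>\<omega>. (X k \<omega> (Suc k * n))\<^sup>2) \<and>
      expectation (\<lambda>\<omega>. (X k \<omega> (Suc k * n))\<^sup>2) \<le> \<eta> * exp (t * (3 * \<bar>g\<bar> + 2 * g\<^sup>2 * t + 2 * \<sigma>\<^sup>2))"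
    if \<eta>: "0 \<le> \<eta>" "\<And>s s'. s \<in> {0..t} \<Longrightarrow> s' \<in> {0..t} \<Longrightarrow> \<bar>s - s'\<bar> \<le> t / real n \<Longrightarrow>
        expectation (\<lambda>\<omega>. (U s \<omega> - U s' \<omega>)\<^sup>2) \<le> \<eta>" for k \<eta>
  proof -
    define q where "q = \<bar>g * h k\<bar> + 2 * (\<bar>g * h k\<bar> + (g * h k)\<^sup>2 + \<sigma>\<^sup>2 * h k)"
    let ?L = "Suc k * n"
    have lt: "real l * h k \<in> {0..t}" if "l < ?L" for l
    proof -
      have "real l * h k \<le> real ?L * h k"
        using h(1)[of k] that by (intro mult_right_mono) (simp_all del: of_nat_mult mult_Suc)
      then show ?thesis using h(1)[of k] unfolding h(3) by simp
    qed
    have d: "expectation (\<lambda>\<omega>. (U (real l * h k) \<omega> - U (real (l - l mod Suc k) * h k) \<omega>)\<^sup>2) \<le> \<eta>"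
      if "l < ?L" for l
    proof (rule \<eta>(2))
      show "real l * h k \<in> {0..t}" "real (l - l mod Suc k) * h k \<in> {0..t}"
        using lt[OF that] lt[of "l - l mod Suc k"] that by auto
      have "real l * h k - real (l - l mod Suc k) * h k = real (l mod Suc k) * h k"
        by (subst of_nat_diff) (simp_all add: left_diff_distrib)
      moreover have "real (l mod Suc k) \<le> real (Suc k)"
        unfolding of_nat_le_iff by (simp add: less_imp_le)
      then have "real (l mod Suc k) * h k \<le> real (Suc k) * h k"
        using h(1)[of k] by (intro mult_right_mono) simp_all
      ultimately show "\<bar>real l * h k - real (l - l mod Suc k) * h k\<bar> \<le> t / real n"
        using h(1)[of k] unfolding h(4) by simp
    qed
    have *: "(\<lambda>\<omega>. X k \<omega> ?L) \<in> borel_measurable (F (real ?L * h k)) \<and> integrable M (\<lambda>\<omega>. (X k \<omega> ?L)\<^sup>2) \<and>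
       expectation (\<lambda>\<omega>. (X k \<omega> ?L)\<^sup>2) \<le> \<eta> * ((1 + q) ^ ?L - 1)"
      unfolding X_def z_def q_def
    proof (rule frozen_euler_moment[OF h(1) \<eta>(1)])
      fix l assume "l < ?L"
      then show "U (real l * h k) \<in> borel_measurable (F (real l * h k))"
        "integrable M (\<lambda>\<omega>. (U (real l * h k) \<omega>)\<^sup>2)"
        "expectation (\<lambda>\<omega>. (U (real l * h k) \<omega> - U (real (l - l mod Suc k) * h k) \<omega>)\<^sup>2) \<le> \<eta>"
        using lt[of l] d[of l] by (auto intro: U_m U_i)
    qed simp
    have "real ?L * q \<le> t * (3 * \<bar>g\<bar> + 2 * g\<^sup>2 * t + 2 * \<sigma>\<^sup>2)"
    proof -
      have "q = h k * (3 * \<bar>g\<bar> + 2 * g\<^sup>2 * h k + 2 * \<sigma>\<^sup>2)"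
        using h(1)[of k] by (simp add: q_def abs_mult power2_eq_square algebra_simps)
      then have "real ?L * q = t * (3 * \<bar>g\<bar> + 2 * g\<^sup>2 * h k + 2 * \<sigma>\<^sup>2)"
        using h(3)[of k] by (simp only: mult.assoc[symmetric])
      also have "\<dots> \<le> t * (3 * \<bar>g\<bar> + 2 * g\<^sup>2 * t + 2 * \<sigma>\<^sup>2)"
        using h(2)[of k] \<open>0 < t\<close> by (intro mult_left_mono add_mono order_refl) auto
      finally show ?thesis .
    qed
    then have le: "exp (real ?L * q) \<le> exp (t * (3 * \<bar>g\<bar> + 2 * g\<^sup>2 * t + 2 * \<sigma>\<^sup>2))"
      by (simp only: exp_le_cancel_iff)
    have "(1 + q) ^ ?L \<le> exp q ^ ?L"
      using h(1)[of k] by (intro power_mono) (auto simp: exp_ge_add_one_self q_def)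
    also have "\<dots> = exp (real ?L * q)" by (simp only: exp_of_nat_mult)
    also note le
    finally have "(1 + q) ^ ?L - 1 \<le> exp (t * (3 * \<bar>g\<bar> + 2 * g\<^sup>2 * t + 2 * \<sigma>\<^sup>2))" by simp
    then have "\<eta> * ((1 + q) ^ ?L - 1) \<le> \<eta> * exp (t * (3 * \<bar>g\<bar> + 2 * g\<^sup>2 * t + 2 * \<sigma>\<^sup>2))"
      using \<eta>(1) by (rule mult_left_mono)
    with * show ?thesis using measurable_F[of "\<lambda>\<omega>. X k \<omega> ?L" "real ?L * h k"] by linarith
  qed
  have X_m: "(\<lambda>\<omega>. X k \<omega> (Suc k * n)) \<in> borel_measurable M" for k
  proof -
    \<comment> \<open>Measurability was obtained together with the moment bound, which asks for an
      admissible \<eta>; the crude value (2 N)^2 always qualifies.\<close>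
    have "expectation (\<lambda>\<omega>. (U s \<omega> - U s' \<omega>)\<^sup>2) \<le> (2 * N)\<^sup>2" if s: "s \<in> {0..t}" "s' \<in> {0..t}" for s s'
    proof -
      have b: "(U s \<omega> - U s' \<omega>)\<^sup>2 \<le> (2 * N)\<^sup>2" for \<omega>
        using U_b[of s \<omega>] U_b[of s' \<omega>] \<open>0 \<le> N\<close> by (simp only: abs_le_square_iff[symmetric])
      have [measurable]: "U s \<in> borel_measurable M" "U s' \<in> borel_measurable M"
        using U_m measurable_F s by auto
      show ?thesis
        using b by (intro integral_le_const integrable_const_bound[where B = "(2 * N)\<^sup>2"]) auto
    qed
    then show ?thesis using X_mom[of "(2 * N)\<^sup>2" k] by simp
  qed
  define A where "A = (\<lambda>i \<omega>. 1 + g * (t / real n) +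
      \<sigma> * (B (real (Suc i) * (t / real n)) \<omega> - B (real i * (t / real n)) \<omega>))"
  have "(\<integral>\<^sup>+\<omega>. f \<omega> \<partial>M) \<le> ennreal (\<eta> * exp (t * (3 * \<bar>g\<bar> + 2 * g\<^sup>2 * t + 2 * \<sigma>\<^sup>2)))"
    if "0 \<le> \<eta>" "\<forall>s\<in>{0..t}. \<forall>s'\<in>{0..t}. \<bar>s - s'\<bar> \<le> t / real n \<longrightarrow> expectation (\<lambda>\<omega>. (U s \<omega> - U s' \<omega>)\<^sup>2) \<le> \<eta>" for \<eta>
  proof -
    have "(\<integral>\<^sup>+\<omega>. f \<omega> \<partial>M) \<le> liminf (\<lambda>m. \<integral>\<^sup>+\<omega>. ennreal ((X (r m) \<omega> (Suc (r m) * n))\<^sup>2) \<partial>M)"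
      unfolding f_def using X_m by (intro nn_integral_liminf) simp
    also have "\<dots> \<le> limsup (\<lambda>m. \<integral>\<^sup>+\<omega>. ennreal ((X (r m) \<omega> (Suc (r m) * n))\<^sup>2) \<partial>M)"
      by (rule Liminf_le_Limsup) simp
    also have "\<dots> \<le> ennreal (\<eta> * exp (t * (3 * \<bar>g\<bar> + 2 * g\<^sup>2 * t + 2 * \<sigma>\<^sup>2)))"
    proof (intro Limsup_bounded always_eventually allI)
      fix m
      show "(\<integral>\<^sup>+\<omega>. ennreal ((X (r m) \<omega> (Suc (r m) * n))\<^sup>2) \<partial>M)
          \<le> ennreal (\<eta> * exp (t * (3 * \<bar>g\<bar> + 2 * g\<^sup>2 * t + 2 * \<sigma>\<^sup>2)))"
        using X_mom[OF that(1), of "r m"] that(2) by (subst nn_integral_eq_integral) (auto intro: ennreal_leI)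
    qed
    finally show ?thesis .
  qed
  moreover have "AE \<omega> in M. (\<forall>s\<in>{0..t}. \<bar>P s \<omega>\<bar> \<le> N) \<longrightarrow> f \<omega> = ennreal ((P t \<omega> - P0 * Q n \<omega>)\<^sup>2)"
    using lim AE_space
  proof eventually_elim
    case (elim \<omega>)
    show ?case
    proof
      assume bounded: "\<forall>s\<in>{0..t}. \<bar>P s \<omega>\<bar> \<le> N"
      have "(\<lambda>m. X (r m) \<omega> (Suc (r m) * i)) \<longlonglongrightarrow> P (real i * (t / real n)) \<omega> - P0 * (\<Prod>j<i. A j \<omega>)"
        if "i \<le> n" for i
        using that
      proof (induction i)
        case 0
        then show ?case using P_0[OF elim(2)] by (simp add: X_def)
      next
        case (Suc i)
        let ?p = "P (real i * (t / real n)) \<omega>"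
        define R where "R = (\<lambda>m i. \<Sum>l<Suc (r m) * i. P (real l * h (r m)) \<omega> * z (r m) \<omega> l)"
        have X_Suc: "X (r m) \<omega> (Suc (r m) * Suc i) = X (r m) \<omega> (Suc (r m) * i) * A i \<omega> +
            (R m (Suc i) - R m i - ?p * (A i \<omega> - 1))" for m
        proof -
          let ?k = "Suc (r m)" and ?h = "h (r m)"
          have node: "real (?k * j) * ?h = real j * (t / real n)" for j
            using h(4)[of "r m"] by (metis mult.assoc mult.commute of_nat_mult)
          have U_P: "U (real l * ?h) \<omega> = P (real l * ?h) \<omega>" if "l \<le> ?k * n" for l
          proof -
            have "real l * ?h \<le> real (?k * n) * ?h"
              using that h(1)[of "r m"] by (intro mult_right_mono) (simp_all del: of_nat_mult mult_Suc)
            then have "\<bar>P (real l * ?h) \<omega>\<bar> \<le> N"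
              using bounded h(1)[of "r m"] unfolding h(3) by simp
            then show ?thesis by (auto simp: U_def)
          qed
          have le: "?k * i + j \<le> ?k * n" if "j < ?k" for j
          proof -
            have "?k * i + j \<le> ?k * Suc i" using that by simp
            also have "\<dots> \<le> ?k * n" using Suc.prems by (rule mult_le_mono2)
            finally show ?thesis .
          qed
          have ki: "?k * i + ?k = ?k * Suc i" by simp
          have "(\<Sum>j<?k. B (real (Suc (?k * i + j)) * ?h) \<omega> - B (real (?k * i + j) * ?h) \<omega>) =
              B (real (Suc i) * (t / real n)) \<omega> - B (real i * (t / real n)) \<omega>"
          proof -
            have "(\<Sum>j<?k. B (real (?k * i + Suc j) * ?h) \<omega> - B (real (?k * i + j) * ?h) \<omega>) =
                B (real (?k * i + ?k) * ?h) \<omega> - B (real (?k * i + 0) * ?h) \<omega>"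
              by (rule sum_lessThan_telescope)
            then show ?thesis unfolding ki add_0_right by (simp only: add_Suc_right node)
          qed
          then have zs: "1 + (\<Sum>j<?k. z (r m) \<omega> (?k * i + j)) = A i \<omega>"
            using h(4)[of "r m"] unfolding z_def A_def sum.distrib sum_distrib_left[symmetric]
            by (simp del: of_nat_Suc of_nat_add of_nat_mult sum.lessThan_Suc add: mult.left_commute[of _ g])
          have Rs: "R m (Suc i) = R m i + (\<Sum>j<?k. P (real (?k * i + j) * ?h) \<omega> * z (r m) \<omega> (?k * i + j))"
            unfolding R_def ki[symmetric] by (rule sum_lessThan_add)
          have zs': "A i \<omega> - 1 = (\<Sum>j<?k. z (r m) \<omega> (?k * i + j))"
            unfolding zs[symmetric] by simp
          have "R m (Suc i) - R m i - ?p * (A i \<omega> - 1) =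
              (\<Sum>j<?k. (P (real (?k * i + j) * ?h) \<omega> - ?p) * z (r m) \<omega> (?k * i + j))"
            unfolding Rs zs' sum_distrib_left left_diff_distrib sum_subtractf by simp
          also have "\<dots> = (\<Sum>j<?k. (U (real (?k * i + j) * ?h) \<omega> - U (real (?k * i) * ?h) \<omega>) * z (r m) \<omega> (?k * i + j))"
            using U_P[OF le] U_P[OF le[of 0]] node[of i] by (intro sum.cong) auto
          finally show ?thesis
            using frozen_euler_block[of ?k "\<lambda>l. U (real l * ?h) \<omega>" "z (r m) \<omega>" i] zs
            by (simp add: X_def)
        qed
        have R_lim: "(\<lambda>m. R m j) \<longlonglongrightarrow> P (real j * (t / real n)) \<omega> - P0" if "j \<le> n" for j
          using elim(1) that unfolding R_def by blast
        \<comment> \<open>In the limit the left sums over the block give the true price increment;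
          all terms in \<open>?p\<close> cancel, and what is left is the price at the next node
          minus the Euler product extended by \<open>A i\<close>.\<close>
        have "(\<lambda>m. X (r m) \<omega> (Suc (r m) * Suc i)) \<longlonglongrightarrow> (?p - P0 * (\<Prod>j<i. A j \<omega>)) * A i \<omega> +
            ((P (real (Suc i) * (t / real n)) \<omega> - P0) - (?p - P0) - ?p * (A i \<omega> - 1))"
          unfolding X_Suc using Suc.prems by (intro tendsto_intros Suc.IH R_lim) simp_all
        then show ?case by (simp add: algebra_simps)
      qed
      from this[of n] have "(\<lambda>m. X (r m) \<omega> (Suc (r m) * n)) \<longlonglongrightarrow> P t \<omega> - P0 * Q n \<omega>"
        using \<open>0 < n\<close> by (simp add: Q_def A_def)
      then have "(\<lambda>m. ennreal ((X (r m) \<omega> (Suc (r m) * n))\<^sup>2)) \<longlonglongrightarrow> ennreal ((P t \<omega> - P0 * Q n \<omega>)\<^sup>2)"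
        by (intro tendsto_intros)
      then show "f \<omega> = ennreal ((P t \<omega> - P0 * Q n \<omega>)\<^sup>2)"
        unfolding f_def by (intro lim_imp_Liminf) simp_all
    qed
  qed
  moreover have "f \<in> borel_measurable M"
    unfolding f_def using X_m by measurable
  ultimately show ?thesis by blast
qed

text \<open>On paths bounded by \<open>N\<close>, the squared distance from \<open>P t\<close> to
  the exponential is controlled by the distance from \<open>P t\<close> to the Euler product plus
  that from the product to the exponential. Both controls have integrals tending to 0 as the number
  of Euler steps grows, so Fatou's lemma gives equality almost surely on such paths.\<close>

lemma price_eq_exponential_at:
  assumes P: "price_process M F B g \<sigma> P0 P" and "0 \<le> t"
  shows "AE \<omega> in M. P t \<omega> = P0 * exp (\<sigma> * B t \<omega> + (g - \<sigma>\<^sup>2 / 2) * t)"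
proof (cases "t = 0")
  case True
  then show ?thesis
    using P B_0 unfolding price_process_def by (intro AE_I2) simp
next
  case False
  then have "0 < t" using \<open>0 \<le> t\<close> by simp
  have P_ad: "P s \<in> borel_measurable M" if "0 \<le> s" for s
    using P that measurable_F unfolding price_process_def continuous_adapted_def by blast
  have P_cont: "continuous_on {0..t} (\<lambda>s. P s \<omega>)" if "\<omega> \<in> space M" for \<omega>
    using P that unfolding price_process_def continuous_adapted_def
    by (auto intro: continuous_on_subset)
  define S where "S = (\<lambda>\<omega>. exp (\<sigma> * B t \<omega> + (g - \<sigma>\<^sup>2 / 2) * t))"
  define Q where "Q = (\<lambda>n \<omega>. \<Prod>i<n. 1 + g * (t / real n) +
      \<sigma> * (B (real (Suc i) * (t / real n)) \<omega> - B (real i * (t / real n)) \<omega>))"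
  have Q_S: "(\<lambda>n. expectation (\<lambda>\<omega>. (Q n \<omega> - S \<omega>)\<^sup>2)) \<longlonglongrightarrow> 0"
    and Q_S_int: "\<And>n. 0 < n \<Longrightarrow> integrable M (\<lambda>\<omega>. (Q n \<omega> - S \<omega>)\<^sup>2)"
    using euler_product_tendsto[OF \<open>0 < t\<close>, where g = g and \<sigma> = \<sigma>] unfolding Q_def S_def by auto
  define K where "K = exp (t * (3 * \<bar>g\<bar> + 2 * g\<^sup>2 * t + 2 * \<sigma>\<^sup>2))"
  have "AE \<omega> in M. (\<forall>s\<in>{0..t}. \<bar>P s \<omega>\<bar> \<le> real N) \<longrightarrow> P t \<omega> = P0 * S \<omega>" for N :: nat
  proof -
    define U where "U = (\<lambda>s \<omega>. max (- real N) (min (real N) (P s \<omega>)))"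
    have "\<forall>n. \<exists>f\<in>borel_measurable M.
      (\<forall>\<eta>\<ge>0. (\<forall>s\<in>{0..t}. \<forall>s'\<in>{0..t}. \<bar>s - s'\<bar> \<le> t / real (Suc n) \<longrightarrow> expectation (\<lambda>\<omega>. (U s \<omega> - U s' \<omega>)\<^sup>2) \<le> \<eta>) \<longrightarrow>
          (\<integral>\<^sup>+\<omega>. f \<omega> \<partial>M) \<le> ennreal (\<eta> * K)) \<and>
      (AE \<omega> in M. (\<forall>s\<in>{0..t}. \<bar>P s \<omega>\<bar> \<le> real N) \<longrightarrow> f \<omega> = ennreal ((P t \<omega> - P0 * Q (Suc n) \<omega>)\<^sup>2))"
      using euler_error[OF P \<open>0 < t\<close> zero_less_Suc of_nat_0_le_iff[of N]] unfolding U_def Q_def K_def by blast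
    from choice[OF this[unfolded Bex_def]] obtain f where f: "\<And>n. f n \<in> borel_measurable M \<and>
      (\<forall>\<eta>\<ge>0. (\<forall>s\<in>{0..t}. \<forall>s'\<in>{0..t}. \<bar>s - s'\<bar> \<le> t / real (Suc n) \<longrightarrow> expectation (\<lambda>\<omega>. (U s \<omega> - U s' \<omega>)\<^sup>2) \<le> \<eta>) \<longrightarrow>
          (\<integral>\<^sup>+\<omega>. f n \<omega> \<partial>M) \<le> ennreal (\<eta> * K)) \<and>
      (AE \<omega> in M. (\<forall>s\<in>{0..t}. \<bar>P s \<omega>\<bar> \<le> real N) \<longrightarrow> f n \<omega> = ennreal ((P t \<omega> - P0 * Q (Suc n) \<omega>)\<^sup>2))"
      by blast
    have f_m[measurable]: "f n \<in> borel_measurable M" for n using f by blast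
    have f_le: "(\<integral>\<^sup>+\<omega>. f n \<omega> \<partial>M) \<le> ennreal (\<eta> * K)"
      if "0 \<le> \<eta>" "\<forall>s\<in>{0..t}. \<forall>s'\<in>{0..t}. \<bar>s - s'\<bar> \<le> t / real (Suc n) \<longrightarrow>
          expectation (\<lambda>\<omega>. (U s \<omega> - U s' \<omega>)\<^sup>2) \<le> \<eta>" for n \<eta>
      using f that by blast
    have f_eq: "AE \<omega> in M. (\<forall>s\<in>{0..t}. \<bar>P s \<omega>\<bar> \<le> real N) \<longrightarrow>
          f n \<omega> = ennreal ((P t \<omega> - P0 * Q (Suc n) \<omega>)\<^sup>2)" for n
      using f by blast
    have f_lim: "(\<lambda>n. \<integral>\<^sup>+\<omega>. f n \<omega> \<partial>M) \<longlonglongrightarrow> 0"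
    proof (rule order_tendstoI)
      fix a :: ennreal assume "0 < a"
      \<comment> \<open>A real number strictly below \<open>a\<close>: the moment bound is a
        non-strict inequality between real multiples, and with \<eta> = e / K it becomes exactly
        \<open>e\<close>.\<close>
      obtain e :: real where e: "0 < e" "ennreal e < a"
      proof -
        obtain y where "0 < y" "y < a" using dense[OF \<open>0 < a\<close>] by blast
        then show ?thesis using that by (cases y) (auto simp: less_top[symmetric])
      qed
      have "0 < K" by (simp add: K_def)
      then have "0 < e / K" using e by simp
      have U_m: "U s \<in> borel_measurable M" if "s \<in> {0..t}" for s
        unfolding U_def using P_ad[of s] that by auto
      have U_b: "\<bar>U s \<omega>\<bar> \<le> real N" for s \<omega> by (auto simp: U_def)
      have U_c: "continuous_on {0..t} (\<lambda>s. U s \<omega>)" if "\<omega> \<in> space M" for \<omega>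
        unfolding U_def by (intro continuous_intros P_cont[OF that])
      obtain \<delta> where "0 < \<delta>" and \<delta>: "\<forall>s\<in>{0..t}. \<forall>s'\<in>{0..t}. \<bar>s - s'\<bar> < \<delta> \<longrightarrow>
          expectation (\<lambda>\<omega>. (U s \<omega> - U s' \<omega>)\<^sup>2) < e / K"
        using uniformly_continuous_in_L2[OF U_m U_b U_c \<open>0 < e / K\<close>] by blast
      have "(\<lambda>n. t / real (Suc n)) \<longlonglongrightarrow> 0" by real_asymp
      then have "\<forall>\<^sub>F n in sequentially. t / real (Suc n) < \<delta>"
        using \<open>0 < \<delta>\<close> by (rule order_tendstoD)
      then show "\<forall>\<^sub>F n in sequentially. (\<integral>\<^sup>+\<omega>. f n \<omega> \<partial>M) < a"
      proof eventually_elim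
        case (elim n)
        have "(\<integral>\<^sup>+\<omega>. f n \<omega> \<partial>M) \<le> ennreal (e / K * K)"
          using \<delta> elim \<open>0 < e / K\<close> by (intro f_le) (auto intro: less_imp_le)
        with e \<open>0 < K\<close> show ?case by simp
      qed
    qed simp
    \<comment> \<open>On paths bounded by \<open>N\<close> this dominates half the squared distance
      between \<open>P t\<close> and \<open>P0 * S\<close>, a quantity free of \<open>n\<close>; its
      integral tends to 0.\<close>
    define H where "H = (\<lambda>n \<omega>. f n \<omega> + ennreal (P0\<^sup>2 * (Q (Suc n) \<omega> - S \<omega>)\<^sup>2))"
    have QS_m[measurable]: "(\<lambda>\<omega>. (Q (Suc n) \<omega> - S \<omega>)\<^sup>2) \<in> borel_measurable M" for n
      using Q_S_int[of "Suc n"] by simp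
    have H_m: "H n \<in> borel_measurable M" for n unfolding H_def by measurable
    have "(\<lambda>n. P0\<^sup>2 * expectation (\<lambda>\<omega>. (Q (Suc n) \<omega> - S \<omega>)\<^sup>2)) \<longlonglongrightarrow> P0\<^sup>2 * 0"
      using LIMSEQ_Suc[OF Q_S] by (intro tendsto_intros)
    then have "(\<lambda>n. ennreal (P0\<^sup>2 * expectation (\<lambda>\<omega>. (Q (Suc n) \<omega> - S \<omega>)\<^sup>2))) \<longlonglongrightarrow> ennreal 0"
      by (intro tendsto_intros) simp
    moreover have "(\<integral>\<^sup>+\<omega>. ennreal (P0\<^sup>2 * (Q (Suc n) \<omega> - S \<omega>)\<^sup>2) \<partial>M) =
        ennreal (P0\<^sup>2 * expectation (\<lambda>\<omega>. (Q (Suc n) \<omega> - S \<omega>)\<^sup>2))" for n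
      using Q_S_int[of "Suc n"] by (subst nn_integral_eq_integral) auto
    ultimately have "(\<lambda>n. (\<integral>\<^sup>+\<omega>. f n \<omega> \<partial>M) + (\<integral>\<^sup>+\<omega>. ennreal (P0\<^sup>2 * (Q (Suc n) \<omega> - S \<omega>)\<^sup>2) \<partial>M)) \<longlonglongrightarrow> 0 + 0"
      using f_lim by (intro tendsto_add) simp_all
    moreover have "(\<integral>\<^sup>+\<omega>. H n \<omega> \<partial>M) = (\<integral>\<^sup>+\<omega>. f n \<omega> \<partial>M) + (\<integral>\<^sup>+\<omega>. ennreal (P0\<^sup>2 * (Q (Suc n) \<omega> - S \<omega>)\<^sup>2) \<partial>M)" for n
      unfolding H_def by (rule nn_integral_add) measurable
    ultimately have "liminf (\<lambda>n. \<integral>\<^sup>+\<omega>. H n \<omega> \<partial>M) = 0"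
      by (intro lim_imp_Liminf) simp_all
    with nn_integral_liminf[of H M] H_m have "(\<integral>\<^sup>+\<omega>. liminf (\<lambda>n. H n \<omega>) \<partial>M) = 0"
      by simp
    then have "AE \<omega> in M. liminf (\<lambda>n. H n \<omega>) = 0"
      using H_m by (subst (asm) nn_integral_0_iff_AE) auto
    moreover have "AE \<omega> in M. \<forall>n. (\<forall>s\<in>{0..t}. \<bar>P s \<omega>\<bar> \<le> real N) \<longrightarrow>
          f n \<omega> = ennreal ((P t \<omega> - P0 * Q (Suc n) \<omega>)\<^sup>2)"
      unfolding AE_all_countable using f_eq by blast
    ultimately show ?thesis
    proof eventually_elim
      case (elim \<omega>)
      show ?case
      proof
        assume "\<forall>s\<in>{0..t}. \<bar>P s \<omega>\<bar> \<le> real N"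
        then have f: "f n \<omega> = ennreal ((P t \<omega> - P0 * Q (Suc n) \<omega>)\<^sup>2)" for n
          using elim(2) by blast
        have "ennreal ((P t \<omega> - P0 * S \<omega>)\<^sup>2 / 2) \<le> H n \<omega>" for n
        proof -
          \<comment> \<open>This elementary inequality is the origin of the factor 1/2.\<close>
          have "(a + b)\<^sup>2 / 2 \<le> a\<^sup>2 + b\<^sup>2" for a b :: real
            using zero_le_power2[of "a - b"] unfolding power2_sum power2_diff by simp
          from this[of "x - y" "y - z" for x y z]
          have sq: "(x - z)\<^sup>2 / 2 \<le> (x - y)\<^sup>2 + (y - z)\<^sup>2" for x y z :: real by simp
          have "(P t \<omega> - P0 * S \<omega>)\<^sup>2 / 2 \<le> (P t \<omega> - P0 * Q (Suc n) \<omega>)\<^sup>2 + P0\<^sup>2 * (Q (Suc n) \<omega> - S \<omega>)\<^sup>2"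
            using sq[of "P t \<omega>" "P0 * S \<omega>" "P0 * Q (Suc n) \<omega>"]
            by (simp add: right_diff_distrib[symmetric] power_mult_distrib)
          then show ?thesis
            unfolding H_def f by (simp add: ennreal_plus[symmetric] del: ennreal_plus)
        qed
        then have "ennreal ((P t \<omega> - P0 * S \<omega>)\<^sup>2 / 2) \<le> liminf (\<lambda>n. H n \<omega>)"
          by (intro Liminf_bounded always_eventually) auto
        then have "(P t \<omega> - P0 * S \<omega>)\<^sup>2 = 0"
          unfolding elim(1) by simp
        then show "P t \<omega> = P0 * S \<omega>" by simp
      qed
    qed
  qed
  then have "AE \<omega> in M. \<forall>N::nat. (\<forall>s\<in>{0..t}. \<bar>P s \<omega>\<bar> \<le> real N) \<longrightarrow> P t \<omega> = P0 * S \<omega>"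
    unfolding AE_all_countable by blast
  then show ?thesis
    using AE_space
  proof eventually_elim
    case (elim \<omega>)
    \<comment> \<open>Continuity on a compact interval puts each path below some natural level, so
      the countably many exceptional null sets suffice.\<close>
    have "compact ((\<lambda>s. P s \<omega>) ` {0..t})"
      using P_cont[OF elim(2)] by (rule compact_continuous_image) simp
    then obtain b where "\<forall>s\<in>{0..t}. \<bar>P s \<omega>\<bar> \<le> b"
      using compact_imp_bounded bounded_iff by (metis image_eqI real_norm_def)
    moreover obtain N :: nat where "b \<le> real N" using real_arch_simple by blast
    ultimately have "\<forall>s\<in>{0..t}. \<bar>P s \<omega>\<bar> \<le> real N" by fastforce
    with elim(1) show ?case unfolding S_def by blast
  qed
qed

text \<open>The price is to be evaluated at a random time, so one null set must serve all times.
  Rational times cost countably many null sets, and continuity of both sides extends the identity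
  from a dense set.\<close>

lemma price_eq_exponential:
  assumes P: "price_process M F B g \<sigma> P0 P"
  shows "AE \<omega> in M. \<forall>t\<ge>0. P t \<omega> = P0 * exp (\<sigma> * B t \<omega> + (g - \<sigma>\<^sup>2 / 2) * t)"
proof -
  have "AE \<omega> in M. \<forall>q\<in>{0..} \<inter> \<rat>. P q \<omega> = P0 * exp (\<sigma> * B q \<omega> + (g - \<sigma>\<^sup>2 / 2) * q)"
    using price_eq_exponential_at[OF P] countable_rat
    by (subst AE_ball_countable) auto
  then show ?thesis
    using AE_space
  proof eventually_elim
    case (elim \<omega>)
    define f where "f = (\<lambda>t. P t \<omega> - P0 * exp (\<sigma> * B t \<omega> + (g - \<sigma>\<^sup>2 / 2) * t))"
    have "continuous_on {0..} (\<lambda>t. B t \<omega>)"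
      using continuous_adapted_B elim(2) unfolding continuous_adapted_def by blast
    then have "continuous_on {0..} f"
      unfolding f_def using P elim(2) unfolding price_process_def continuous_adapted_def
      by (intro continuous_intros) auto
    moreover have "closure ({0..} \<inter> \<rat>) = {0::real..}"
      using closure_convex_Int_superset[of "{0::real..}" \<rat>]
      by (simp add: Rats_closure_real interior_real_atLeast)
    moreover have "f q = 0" if "q \<in> {0..} \<inter> \<rat>" for q
      using bspec[OF elim(1) that] by (simp add: f_def)
    ultimately have "f t = 0" if "0 \<le> t" for t
      using continuous_constant_on_closure[of "{0..} \<inter> \<rat>" f 0 t] that by simp
    then show ?case by (simp add: f_def)
  qed
qed

end

subsection \<open>Hitting times of lines\<close>

text \<open>Rounding the random time up to multiples of 1/(n+1) leaves countably many values, for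
  which measurability is clear; path continuity passes it to the limit.\<close>

lemma measurable_process_at_random_time:
  fixes X :: "real \<Rightarrow> 'a \<Rightarrow> real" and \<tau> :: "'a \<Rightarrow> real"
  assumes X: "\<And>s. 0 \<le> s \<Longrightarrow> X s \<in> borel_measurable M"
    and cont: "\<And>\<omega>. \<omega> \<in> space M \<Longrightarrow> continuous_on {0..} (\<lambda>s. X s \<omega>)"
    and \<tau>[measurable]: "\<tau> \<in> borel_measurable M" and nonneg: "\<And>\<omega>. 0 \<le> \<tau> \<omega>"
  shows "(\<lambda>\<omega>. X (\<tau> \<omega>) \<omega>) \<in> borel_measurable M"
proof (rule borel_measurable_LIMSEQ_real)
  let ?s = "\<lambda>n \<omega>. real (nat \<lceil>real (Suc n) * \<tau> \<omega>\<rceil>) / real (Suc n)"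
  show "(\<lambda>\<omega>. X (?s n \<omega>) \<omega>) \<in> borel_measurable M" for n
  proof (rule measurable_compose_countable[where f = "\<lambda>i \<omega>. X (real i / real (Suc n)) \<omega>"])
    show "(\<lambda>\<omega>. X (real i / real (Suc n)) \<omega>) \<in> borel_measurable M" for i :: nat
      by (intro X) simp
    show "(\<lambda>\<omega>. nat \<lceil>real (Suc n) * \<tau> \<omega>\<rceil>) \<in> M \<rightarrow>\<^sub>M count_space UNIV"
      by measurable
  qed
  show "(\<lambda>n. X (?s n \<omega>) \<omega>) \<longlonglongrightarrow> X (\<tau> \<omega>) \<omega>" if "\<omega> \<in> space M" for \<omega>
  proof -
    have "\<tau> \<omega> \<le> ?s n \<omega>" "?s n \<omega> \<le> \<tau> \<omega> + 1 / real (Suc n)" for n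
    proof -
      have eq: "real (nat \<lceil>real (Suc n) * \<tau> \<omega>\<rceil>) = real_of_int \<lceil>real (Suc n) * \<tau> \<omega>\<rceil>"
      proof (rule of_nat_nat)
        have "0 \<le> real (Suc n) * \<tau> \<omega>" using nonneg[of \<omega>] by simp
        then show "0 \<le> \<lceil>real (Suc n) * \<tau> \<omega>\<rceil>" unfolding zero_le_ceiling by linarith
      qed
      have "real (Suc n) * \<tau> \<omega> \<le> real_of_int \<lceil>real (Suc n) * \<tau> \<omega>\<rceil>" by (rule le_of_int_ceiling)
      then show "\<tau> \<omega> \<le> ?s n \<omega>" unfolding eq by (simp add: pos_le_divide_eq mult.commute)
      have "real_of_int \<lceil>real (Suc n) * \<tau> \<omega>\<rceil> \<le> real (Suc n) * \<tau> \<omega> + 1" by (rule of_int_ceiling_le_add_one)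
      then have "?s n \<omega> \<le> (real (Suc n) * \<tau> \<omega> + 1) / real (Suc n)"
        unfolding eq by (intro divide_right_mono) simp_all
      then show "?s n \<omega> \<le> \<tau> \<omega> + 1 / real (Suc n)" by (simp add: add_divide_distrib)
    qed
    note s = this
    have lim: "(\<lambda>n. ?s n \<omega>) \<longlonglongrightarrow> \<tau> \<omega>"
    proof (rule tendsto_sandwich[OF always_eventually always_eventually])
      show "\<forall>n. \<tau> \<omega> \<le> ?s n \<omega>" "\<forall>n. ?s n \<omega> \<le> \<tau> \<omega> + 1 / real (Suc n)" using s by blast+
      show "(\<lambda>n. \<tau> \<omega> + 1 / real (Suc n)) \<longlonglongrightarrow> \<tau> \<omega>" by real_asymp
    qed (rule tendsto_const)
    show ?thesis
    proof (rule continuous_on_tendsto_compose[OF cont[OF that] lim])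
      show "\<tau> \<omega> \<in> {0..}" using nonneg by simp
      have "\<forall>n. ?s n \<omega> \<in> {0..}" by (intro allI) (simp only: atLeast_iff divide_nonneg_nonneg of_nat_0_le_iff)
      then show "\<forall>\<^sub>F n in sequentially. ?s n \<omega> \<in> {0..}" by (rule always_eventually)
    qed
  qed
qed

text \<open>An L2 bound gives uniform integrability. Concretely, x \<le> min x K + x^2/K for x \<ge>
  0, so truncation at \<open>K\<close> loses at most C/K in expectation; truncated functions
  converge by domination, and once \<open>K\<close> exceeds \<open>K0\<close> the limit is
  unaffected by truncation.\<close>

lemma (in prob_space) expectation_limit_of_L2_bounded:
  fixes f :: "nat \<Rightarrow> 'a \<Rightarrow> real"
  assumes f: "\<And>n. integrable M (f n)" "\<And>n. integrable M (\<lambda>\<omega>. (f n \<omega>)\<^sup>2)"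
    and nonneg: "\<And>n \<omega>. 0 \<le> f n \<omega>"
    and a: "\<And>n. expectation (f n) = a" and C: "\<And>n. expectation (\<lambda>\<omega>. (f n \<omega>)\<^sup>2) \<le> C"
    and lim: "\<And>\<omega>. \<omega> \<in> space M \<Longrightarrow> (\<lambda>n. f n \<omega>) \<longlonglongrightarrow> h \<omega>"
    and bound: "\<And>\<omega>. \<omega> \<in> space M \<Longrightarrow> h \<omega> \<le> K0"
  shows "expectation h = a"
proof -
  have h_m: "h \<in> borel_measurable M"
    by (rule borel_measurable_LIMSEQ_real[OF lim borel_measurable_integrable[OF f(1)]])
  have *: "expectation h \<le> a \<and> a \<le> expectation h + C / K" if K: "K0 \<le> K" "0 < K" for K
  proof -
    have int: "integrable M (\<lambda>\<omega>. min (f n \<omega>) K)" for n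
      using f(1)[of n] nonneg[of n] K(2) by (intro integrable_const_bound[where B = K]) auto
    have conv: "(\<lambda>n. expectation (\<lambda>\<omega>. min (f n \<omega>) K)) \<longlonglongrightarrow> expectation h"
    proof (rule integral_dominated_convergence[where w = "\<lambda>_. K"])
      show "AE \<omega> in M. (\<lambda>n. min (f n \<omega>) K) \<longlonglongrightarrow> h \<omega>"
      proof (rule AE_I2)
        fix \<omega> assume \<omega>: "\<omega> \<in> space M"
        have "(\<lambda>n. min (f n \<omega>) K) \<longlonglongrightarrow> min (h \<omega>) K"
          by (intro tendsto_min lim[OF \<omega>] tendsto_const)
        then show "(\<lambda>n. min (f n \<omega>) K) \<longlonglongrightarrow> h \<omega>"
          using bound[OF \<omega>] K by (simp add: min_absorb1)
      qed
    qed (use h_m f(1) nonneg K in \<open>auto intro!: AE_I2\<close>)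
    have "expectation (\<lambda>\<omega>. min (f n \<omega>) K) \<le> a" for n
      unfolding a[of n, symmetric] by (intro integral_mono int f(1)) auto
    moreover have "a - C / K \<le> expectation (\<lambda>\<omega>. min (f n \<omega>) K)" for n
    proof -
      have "x \<le> min x K + x\<^sup>2 / K" if "0 \<le> x" for x
      proof (cases "x \<le> K")
        case False
        then have "x * K \<le> x * x" using that by (intro mult_left_mono) auto
        then have "x \<le> x\<^sup>2 / K" using K by (simp add: pos_le_divide_eq power2_eq_square)
        then show ?thesis using K False by (simp add: min_def)
      qed (use K in \<open>simp add: min_def\<close>)
      then have "a \<le> expectation (\<lambda>\<omega>. min (f n \<omega>) K + (f n \<omega>)\<^sup>2 / K)"
        unfolding a[of n, symmetric] using f nonneg int by (intro integral_mono) auto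
      also have "\<dots> = expectation (\<lambda>\<omega>. min (f n \<omega>) K) + expectation (\<lambda>\<omega>. (f n \<omega>)\<^sup>2) / K"
        using f int by (subst Bochner_Integration.integral_add) auto
      also have "\<dots> \<le> expectation (\<lambda>\<omega>. min (f n \<omega>) K) + C / K"
        using C[of n] K by (simp add: divide_right_mono)
      finally show ?thesis by simp
    qed
    ultimately show ?thesis
      using LIMSEQ_le_const2[OF conv] LIMSEQ_le_const[OF conv, of "a - C / K"] by fastforce
  qed
  have "expectation h \<le> a" using *[of "max K0 1"] by simp
  moreover have "a \<le> expectation h"
  proof (rule ccontr)
    assume "\<not> a \<le> expectation h"
    then have \<epsilon>: "0 < a - expectation h" by simp
    \<comment> \<open>Large enough that C/K falls short of the supposed gap a - E h; the
      \<open>+ 1\<close> makes the contradiction strict.\<close>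
    define K where "K = max (max K0 1) ((\<bar>C\<bar> + 1) / (a - expectation h))"
    have K: "K0 \<le> K" "0 < K" "(\<bar>C\<bar> + 1) / (a - expectation h) \<le> K" by (auto simp: K_def)
    have "\<bar>C\<bar> + 1 \<le> K * (a - expectation h)"
      using K(3) \<epsilon> by (simp add: pos_divide_le_eq)
    moreover have "K * (a - expectation h) \<le> C"
      using *[OF K(1,2)] K(2) by (simp add: field_simps)
    ultimately show False by linarith
  qed
  ultimately show ?thesis by simp
qed

section \<open>The hitting time as a stopping time\<close>

context brownian_motion
begin

lemma continuous_on_B: "\<omega> \<in> space M \<Longrightarrow> continuous_on {0..} (\<lambda>t. B t \<omega>)"
  using continuous_adapted_B unfolding continuous_adapted_def by blast

text \<open>By path continuity the set of meeting times is closed, so a nonempty one contains its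
  infimum and the path really lies on the line at a finite hitting time.\<close>

lemma hitting_time_cases [consumes 1, case_names infinite finite]:
  assumes "\<omega> \<in> space M"
  obtains (infinite) "hitting_time B c d \<omega> = \<infinity>" "\<And>s. 0 \<le> s \<Longrightarrow> B s \<omega> \<noteq> c + d * s"
  | (finite) \<tau> where "hitting_time B c d \<omega> = ereal \<tau>" "0 \<le> \<tau>" "B \<tau> \<omega> = c + d * \<tau>"
      "\<And>s. 0 \<le> s \<Longrightarrow> s < \<tau> \<Longrightarrow> B s \<omega> \<noteq> c + d * s"
proof -
  let ?A = "{t. 0 \<le> t \<and> B t \<omega> = c + d * t}"
  show thesis
  proof (cases "?A = {}")
    case True
    have "hitting_time B c d \<omega> = \<infinity>"
      unfolding hitting_time_def True by (simp add: top_ereal_def)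
    with True show thesis by (intro infinite) auto
  next
    case False
    have "closed {t \<in> {0..}. B t \<omega> - (c + d * t) = 0}"
      using continuous_on_B[OF assms]
      by (intro continuous_closed_preimage_constant continuous_intros) auto
    then have "closed ?A" by (simp add: conj_commute)
    moreover have bdd: "bdd_below ?A" by (auto intro!: bdd_belowI[of _ 0])
    ultimately have Inf: "Inf ?A \<in> ?A"
      using closed_contains_Inf[OF False] by blast
    show thesis
    proof (rule finite)
      show "hitting_time B c d \<omega> = ereal (Inf ?A)"
        unfolding hitting_time_def using ereal_Inf'[OF bdd False] by simp
      show "B s \<omega> \<noteq> c + d * s" if "0 \<le> s" "s < Inf ?A" for s
        using cInf_lower[OF _ bdd, of s] that by auto
    qed (use Inf in auto)
  qed
qed

lemma hitting_time_le_iff: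
  assumes "\<omega> \<in> space M"
  shows "hitting_time B c d \<omega> \<le> ereal t \<longleftrightarrow> (\<exists>s\<in>{0..t}. B s \<omega> = c + d * s)"
  using assms
proof (cases rule: hitting_time_cases[where c = c and d = d])
  case (finite \<tau>)
  then show ?thesis by (force simp: not_le)
qed auto

text \<open>By compactness the distance to the line attains its minimum on \<open>[0, t]\<close>,
  and by density of the rationals this minimum is 0 exactly when rational times bring the distance
  below every 1/(k+1). That is a countable condition on the path up to time
  \<open>t\<close>.\<close>

lemma sets_hitting_time_le:
  "{\<omega> \<in> space M. hitting_time B c d \<omega> \<le> ereal t} \<in> sets (F t)"
proof (cases "0 < t")
  case True
  let ?Y = "\<lambda>s \<omega>. \<bar>B s \<omega> - (c + d * s)\<bar>"
  have cl: "closure ({0..t} \<inter> \<rat>) = {0..t}"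
    using closure_convex_Int_superset[of "{0..t}" \<rat>] True by (simp add: Rats_closure_real)
  have "(\<exists>s\<in>{0..t}. B s \<omega> = c + d * s) \<longleftrightarrow> (\<forall>k::nat. \<exists>q\<in>{0..t} \<inter> \<rat>. ?Y q \<omega> < 1 / real (Suc k))"
    if "\<omega> \<in> space M" for \<omega>
  proof -
    have cont: "continuous_on {0..t} (\<lambda>s. ?Y s \<omega>)"
      by (intro continuous_intros continuous_on_subset[OF continuous_on_B[OF that]]) auto
    show ?thesis
    proof (intro iffI allI)
      fix k :: nat assume "\<exists>s\<in>{0..t}. B s \<omega> = c + d * s"
      then obtain s where s: "s \<in> {0..t}" "?Y s \<omega> = 0" by auto
      show "\<exists>q\<in>{0..t} \<inter> \<rat>. ?Y q \<omega> < 1 / real (Suc k)"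
      proof (rule ccontr)
        assume "\<not> ?thesis"
        then have "\<And>q. q \<in> {0..t} \<inter> \<rat> \<Longrightarrow> 1 / real (Suc k) \<le> ?Y q \<omega>" by (meson not_le)
        from continuous_ge_on_closure[of "{0..t} \<inter> \<rat>" "\<lambda>s. ?Y s \<omega>" s "1 / real (Suc k)"] this s(1) cont
        have "1 / real (Suc k) \<le> ?Y s \<omega>" unfolding cl by blast
        moreover have "0 < 1 / real (Suc k)" by simp
        ultimately show False using s(2) by linarith
      qed
    next
      assume small: "\<forall>k::nat. \<exists>q\<in>{0..t} \<inter> \<rat>. ?Y q \<omega> < 1 / real (Suc k)"
      obtain s where s: "s \<in> {0..t}" "\<And>s'. s' \<in> {0..t} \<Longrightarrow> ?Y s \<omega> \<le> ?Y s' \<omega>"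
        using continuous_attains_inf[OF compact_Icc _ cont] True by fastforce
      have "?Y s \<omega> \<le> 0"
      proof (rule ccontr)
        assume "\<not> ?Y s \<omega> \<le> 0"
        then obtain k where "inverse (real (Suc k)) < ?Y s \<omega>"
          using reals_Archimedean by (meson not_le)
        moreover obtain q where "q \<in> {0..t} \<inter> \<rat>" "?Y q \<omega> < 1 / real (Suc k)"
          using small by blast
        ultimately show False using s(2)[of q] by (simp add: inverse_eq_divide)
      qed
      then show "\<exists>s\<in>{0..t}. B s \<omega> = c + d * s" using s(1) by auto
    qed
  qed
  then have "{\<omega> \<in> space M. hitting_time B c d \<omega> \<le> ereal t} =
      {\<omega> \<in> space M. \<forall>k::nat. \<exists>q\<in>{0..t} \<inter> \<rat>. ?Y q \<omega> < 1 / real (Suc k)}"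
    using hitting_time_le_iff by auto
  also have "\<dots> = (\<Inter>k::nat. \<Union>q\<in>{0..t} \<inter> \<rat>. {\<omega> \<in> space (F t). ?Y q \<omega> < 1 / real (Suc k)})"
    using True by (auto simp: space_F)
  also have "\<dots> \<in> sets (F t)"
  proof (intro sets.countable_INT sets.countable_UN'' image_subsetI)
    show "countable ({0..t} \<inter> \<rat>)" using countable_rat by blast
    fix k :: nat and q assume "q \<in> {0..t} \<inter> \<rat>"
    then have [measurable]: "B q \<in> borel_measurable (F t)"
      by (intro B_measurable_F) auto
    show "{\<omega> \<in> space (F t). ?Y q \<omega> < 1 / real (Suc k)} \<in> sets (F t)" by measurable
  qed simp
  finally show ?thesis .
next
  \<comment> \<open>The density argument used an interval with nonempty interior. At t = 0 only the
    start B 0 = 0 counts, so the event is everything or nothing according to \<open>c\<close>; for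
    negative \<open>t\<close> it is empty.\<close>
  case False
  have "{\<omega> \<in> space M. hitting_time B c d \<omega> \<le> ereal t} =
      (if t = 0 \<and> c = 0 then space (F t) else {})"
  proof -
    have "{0..t} = (if t = 0 then {0} else {})" using False by auto
    then show ?thesis
      using hitting_time_le_iff[of _ c d t] B_0 by (auto simp: space_F)
  qed
  then show ?thesis by simp
qed

lemma hitting_time_measurable: "hitting_time B c d \<in> borel_measurable M"
proof (rule borel_measurableI_le)
  fix y :: ereal
  show "{\<omega> \<in> space M. hitting_time B c d \<omega> \<le> y} \<in> events"
  proof (cases y)
    case (real t)
    then show ?thesis
      using sets_hitting_time_le[of c d t] subalgebra_F[of t] unfolding subalgebra_def by auto
  next
    case MInf
    have "hitting_time B c d \<omega> \<noteq> - \<infinity>" if "\<omega> \<in> space M" for \<omega>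
      using that by (cases rule: hitting_time_cases[where c = c and d = d]) auto
    then have "{\<omega> \<in> space M. hitting_time B c d \<omega> \<le> y} = {}" using MInf by auto
    then show ?thesis by (simp only: sets.empty_sets)
  qed simp
qed

section \<open>The exponential martingale and the Laplace transform of the hitting time\<close>

lemma exponential_martingale:
  assumes "0 \<le> s" "s \<le> t" and A: "A \<in> sets (F s)"
  shows "integrable M (\<lambda>\<omega>. exp (\<theta> * B t \<omega> - \<theta>\<^sup>2 / 2 * t))"
    "expectation (\<lambda>\<omega>. exp (\<theta> * B t \<omega> - \<theta>\<^sup>2 / 2 * t) * indicator A \<omega>) =
     expectation (\<lambda>\<omega>. exp (\<theta> * B s \<omega> - \<theta>\<^sup>2 / 2 * s) * indicator A \<omega>)"
proof -
  have int: "integrable M (\<lambda>\<omega>. exp (\<theta> * B t \<omega> - \<theta>\<^sup>2 / 2 * t))" if "0 \<le> t" for t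
  proof (cases "t = 0")
    case True
    have "integrable M (\<lambda>\<omega>. exp (\<theta> * B t \<omega> - \<theta>\<^sup>2 / 2 * t)) \<longleftrightarrow> integrable M (\<lambda>\<omega>. 1 :: real)"
      using B_0 True by (intro Bochner_Integration.integrable_cong) auto
    then show ?thesis by simp
  next
    case False
    have "integrable M (\<lambda>\<omega>. exp (- (\<theta>\<^sup>2 / 2 * t)) * exp (\<theta> * (B t \<omega> - B 0 \<omega>)))"
      using increment_exp(1)[of 0 t \<theta>] that False by (intro integrable_mult_right) auto
    moreover have "integrable M (\<lambda>\<omega>. exp (- (\<theta>\<^sup>2 / 2 * t)) * exp (\<theta> * (B t \<omega> - B 0 \<omega>))) \<longleftrightarrow>
        integrable M (\<lambda>\<omega>. exp (\<theta> * B t \<omega> - \<theta>\<^sup>2 / 2 * t))"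
      using B_0 by (intro Bochner_Integration.integrable_cong) (auto simp: exp_add[symmetric])
    ultimately show ?thesis by blast
  qed
  show "integrable M (\<lambda>\<omega>. exp (\<theta> * B t \<omega> - \<theta>\<^sup>2 / 2 * t))" using int assms by simp
  show "expectation (\<lambda>\<omega>. exp (\<theta> * B t \<omega> - \<theta>\<^sup>2 / 2 * t) * indicator A \<omega>) =
     expectation (\<lambda>\<omega>. exp (\<theta> * B s \<omega> - \<theta>\<^sup>2 / 2 * s) * indicator A \<omega>)"
  proof (cases "s = t")
    case False
    then have st: "0 \<le> s" "s < t" using assms by auto
    let ?X = "\<lambda>\<omega>. exp (\<theta> * B s \<omega> - \<theta>\<^sup>2 / 2 * s) * indicator A \<omega> :: real"
    have AM: "A \<in> events" using A subalgebra_F[of s] unfolding subalgebra_def by auto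
    have B: "B s \<in> borel_measurable (F s)" using st by (intro B_measurable_F) auto
    have X: "?X \<in> borel_measurable (F s)" using A B by measurable
    have Xi: "integrable M ?X"
      using int[OF st(1)] AM by (intro integrable_real_mult_indicator)
    \<comment> \<open>The past value, restricted to \<open>A\<close>, is independent of the
      increment, whose exponential moment is exactly what the compensator removes.\<close>
    have "expectation (\<lambda>\<omega>. ?X \<omega> * exp (\<theta> * (B t \<omega> - B s \<omega>))) =
        expectation ?X * exp (\<theta>\<^sup>2 * (t - s) / 2)"
      using increment_mult(2)[OF st X Xi, of "\<lambda>x. exp (\<theta> * x)"] increment_exp(1,2)[OF st, of \<theta>] by simp
    moreover have "exp (\<theta> * B t \<omega> - \<theta>\<^sup>2 / 2 * t) * indicator A \<omega> =
        exp (- (\<theta>\<^sup>2 * (t - s) / 2)) * (?X \<omega> * exp (\<theta> * (B t \<omega> - B s \<omega>)))" for \<omega>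
      by (simp add: exp_add[symmetric] indicator_def field_simps)
    ultimately have "expectation (\<lambda>\<omega>. exp (\<theta> * B t \<omega> - \<theta>\<^sup>2 / 2 * t) * indicator A \<omega>) =
        exp (- (\<theta>\<^sup>2 * (t - s) / 2)) * (expectation ?X * exp (\<theta>\<^sup>2 * (t - s) / 2))"
      by (simp only: integral_mult_right_zero)
    also have "\<dots> = expectation ?X"
      by (simp add: exp_minus)
    finally show ?thesis .
  qed simp
qed

text \<open>
  The hitting time is approximated from above by grid times; the stopped values are not dominated,
  but the martingale for \<open>2 \<theta>\<close> bounds their second moments.
\<close>

lemma optional_stopping_at_hitting_time:
  fixes \<theta> :: real
  assumes "c \<noteq> 0" "0 < t"
  shows "expectation (\<lambda>\<omega>. if hitting_time B c d \<omega> \<le> ereal t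
        then exp (\<theta> * (c + d * real_of_ereal (hitting_time B c d \<omega>)) - \<theta>\<^sup>2 / 2 * real_of_ereal (hitting_time B c d \<omega>))
        else 0) =
      expectation (\<lambda>\<omega>. exp (\<theta> * B t \<omega> - \<theta>\<^sup>2 / 2 * t) *
        indicator {\<omega> \<in> space M. hitting_time B c d \<omega> \<le> ereal t} \<omega>)"
proof -
  let ?T = "hitting_time B c d"
  define E where "E = (\<lambda>\<theta> s \<omega>. exp (\<theta> * B s \<omega> - \<theta>\<^sup>2 / 2 * s))"
  define u where "u = (\<lambda>n i. t * real i / real (Suc n))"
  define H where "H = (\<lambda>s. {\<omega> \<in> space M. ?T \<omega> \<le> ereal s})"
  \<comment> \<open>The martingale evaluated at the first grid time not before the hitting time: the
    \<open>i\<close>-th event says that the hitting time lies in the half-open cell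
    \<open>(u n i, u n (Suc i)]\<close>. The parameter \<theta> is kept free because 2 \<theta> is
    needed as well.\<close>
  define f where "f = (\<lambda>\<theta> n \<omega>. \<Sum>i<Suc n. E \<theta> (u n (Suc i)) \<omega> * indicator (H (u n (Suc i)) - H (u n i)) \<omega>)"
  have u: "0 \<le> u n i" "u n i \<le> u n (Suc i)" "u n (Suc i) = u n i + t / real (Suc n)" "u n 0 = 0" "u n (Suc n) = t" for n i
  proof -
    show 3: "u n (Suc i) = u n i + t / real (Suc n)"
      by (simp add: u_def add_divide_distrib[symmetric] distrib_left)
    show "u n (Suc n) = t" unfolding u_def by (simp del: of_nat_Suc)
    show "0 \<le> u n i" using \<open>0 < t\<close> by (simp add: u_def)
    show "u n i \<le> u n (Suc i)" using \<open>0 < t\<close> unfolding 3 by simp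
    show "u n 0 = 0" by (simp add: u_def)
  qed
  have u_mono: "u n i \<le> u n j" if "i \<le> j" for n i j
    using that \<open>0 < t\<close> by (auto simp: u_def intro!: divide_right_mono mult_left_mono)
  have H_F: "H s \<in> sets (F s')" if "s \<le> s'" for s s'
    using sets_hitting_time_le sets_F_mono[OF that] unfolding H_def by blast
  have H_M: "H s \<in> events" for s
    using H_F[of s s] subalgebra_F[of s] unfolding subalgebra_def by auto
  \<comment> \<open>As c is not 0, the line is not met at time 0, so the half-open cells cover all
    of \<open>H t\<close>.\<close>
  have pos: "\<omega> \<notin> H 0" for \<omega>
    using hitting_time_le_iff[of \<omega> c d 0] B_0[of \<omega>] \<open>c \<noteq> 0\<close> by (auto simp: H_def)
  have E_int: "integrable M (E \<theta> s)" if "0 \<le> s" for \<theta> s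
    unfolding E_def using that by (intro exponential_martingale(1)[of s s "{}"]) auto
  have EA_int: "integrable M (\<lambda>\<omega>. E \<theta> s \<omega> * indicator A \<omega>)" if "0 \<le> s" "A \<in> events" for \<theta> s A
    using E_int that by (intro integrable_real_mult_indicator)
  have f_int: "integrable M (f \<theta> n)" for \<theta> n
    unfolding f_def using H_M u by (intro Bochner_Integration.integrable_sum EA_int) auto
  \<comment> \<open>Each cell event is known at the right end of its cell, so the martingale
    property lets that grid time be replaced by \<open>t\<close>; the indicators then telescope to
    that of \<open>H t\<close>.\<close>
  have f_exp: "expectation (f \<theta> n) = expectation (\<lambda>\<omega>. E \<theta> t \<omega> * indicator (H t) \<omega>)" for \<theta> n
  proof -
    have "expectation (f \<theta> n) = (\<Sum>i<Suc n. expectation (\<lambda>\<omega>. E \<theta> (u n (Suc i)) \<omega> * indicator (H (u n (Suc i)) - H (u n i)) \<omega>))"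
      unfolding f_def using H_M u by (intro Bochner_Integration.integral_sum EA_int) auto
    also have "\<dots> = (\<Sum>i<Suc n. expectation (\<lambda>\<omega>. E \<theta> t \<omega> * indicator (H (u n (Suc i)) - H (u n i)) \<omega>))"
    proof (rule sum.cong[OF refl])
      fix i assume "i \<in> {..<Suc n}"
      then have "u n (Suc i) \<le> t" using u_mono[of "Suc i" "Suc n" n] u(5)[of n] by simp
      then show "expectation (\<lambda>\<omega>. E \<theta> (u n (Suc i)) \<omega> * indicator (H (u n (Suc i)) - H (u n i)) \<omega>) =
          expectation (\<lambda>\<omega>. E \<theta> t \<omega> * indicator (H (u n (Suc i)) - H (u n i)) \<omega>)"
        unfolding E_def using u H_F
        by (intro exponential_martingale(2)[symmetric] sets.Diff) auto
    qed
    also have "\<dots> = expectation (\<lambda>\<omega>. \<Sum>i<Suc n. E \<theta> t \<omega> * indicator (H (u n (Suc i)) - H (u n i)) \<omega>)"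
      using H_M \<open>0 < t\<close> by (intro Bochner_Integration.integral_sum[symmetric] EA_int) auto
    also have "\<dots> = expectation (\<lambda>\<omega>. E \<theta> t \<omega> * indicator (H t) \<omega>)"
    proof (rule Bochner_Integration.integral_cong[OF refl])
      fix \<omega>
      have "indicator (H (u n (Suc i)) - H (u n i)) \<omega> = indicator (H (u n (Suc i))) \<omega> - (indicator (H (u n i)) \<omega> :: real)" for i
        using u(2)[of n i] order_trans[of "?T \<omega>" "ereal (u n i)" "ereal (u n (Suc i))"]
        by (auto simp: indicator_def H_def)
      then have "(\<Sum>i<Suc n. indicator (H (u n (Suc i)) - H (u n i)) \<omega>) = (indicator (H (u n (Suc n))) \<omega> - indicator (H (u n 0)) \<omega> :: real)"
        using sum_lessThan_telescope[of "\<lambda>i. indicator (H (u n i)) \<omega> :: real" "Suc n"] by simp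
      then show "(\<Sum>i<Suc n. E \<theta> t \<omega> * indicator (H (u n (Suc i)) - H (u n i)) \<omega>) = E \<theta> t \<omega> * indicator (H t) \<omega>"
        unfolding sum_distrib_left[symmetric] u(4,5) using pos by simp
    qed
    finally show ?thesis .
  qed
  have f_cases: "\<exists>s\<ge>0. \<tau> \<le> s \<and> s \<le> \<tau> + t / real (Suc n) \<and> s \<le> t \<and> (\<forall>\<theta>. f \<theta> n \<omega> = E \<theta> s \<omega>)"
    if \<omega>: "\<omega> \<in> space M" "?T \<omega> = ereal \<tau>" "\<tau> \<le> t" for \<omega> \<tau> n
  proof -
    define i where "i = (LEAST i. \<tau> \<le> u n (Suc i))"
    have i: "\<tau> \<le> u n (Suc i)" "i \<le> n"
      unfolding i_def using u(5)[of n] \<omega>(3) by (auto intro: LeastI Least_le)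
    have i': "u n i < \<tau>"
    proof (cases i)
      case 0
      then show ?thesis using pos[of \<omega>] \<omega> u(4) by (simp add: H_def)
    next
      case (Suc j)
      then show ?thesis using not_less_Least[of j "\<lambda>i. \<tau> \<le> u n (Suc i)"] by (simp add: i_def)
    qed
    have "indicator (H (u n (Suc j)) - H (u n j)) \<omega> = (if j = i then 1 else 0 :: real)" for j
    proof -
      consider "j = i" | "Suc j \<le> i" | "Suc i \<le> j" by linarith
      then show ?thesis
      proof cases
        case 1
        then show ?thesis using i(1) i' \<omega> by (simp add: H_def)
      next
        case 2
        then show ?thesis using u_mono[OF 2, of n] i' \<omega> by (simp add: H_def)
      next
        case 3
        then show ?thesis using u_mono[OF 3, of n] i(1) \<omega> by (simp add: H_def)
      qed
    qed
    then have "f \<theta> n \<omega> = (\<Sum>j<Suc n. if j = i then E \<theta> (u n (Suc j)) \<omega> else 0)" for \<theta>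
      unfolding f_def by (intro sum.cong) auto
    also have "\<dots> \<theta> = E \<theta> (u n (Suc i)) \<omega>" for \<theta>
      using i(2) by (simp add: sum.delta del: sum.lessThan_Suc)
    finally have "f \<theta> n \<omega> = E \<theta> (u n (Suc i)) \<omega>" for \<theta> .
    moreover have "u n (Suc i) \<le> t" using u_mono[of "Suc i" "Suc n" n] i(2) u(5)[of n] by simp
    moreover have "u n (Suc i) \<le> \<tau> + t / real (Suc n)" using i' u(3)[of n i] by linarith
    ultimately show ?thesis using i(1) u(1)[of n "Suc i"] by blast
  qed
  have f_zero: "f \<theta> n \<omega> = 0" if "\<omega> \<in> space M" "\<not> ?T \<omega> \<le> ereal t" for \<omega> \<theta> n
  proof -
    have "\<omega> \<notin> H (u n (Suc i))" if "i < Suc n" for i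
    proof -
      have "ereal (u n (Suc i)) \<le> ereal t" using u_mono[of "Suc i" "Suc n" n] that u(5)[of n] by simp
      then show ?thesis using \<open>\<not> ?T \<omega> \<le> ereal t\<close>
        order_trans[of "?T \<omega>" "ereal (u n (Suc i))" "ereal t"] by (auto simp: H_def)
    qed
    then show ?thesis unfolding f_def by (intro sum.neutral) auto
  qed
  have real_T: "\<exists>\<tau>. ?T \<omega> = ereal \<tau> \<and> 0 \<le> \<tau> \<and> \<tau> \<le> t \<and> B \<tau> \<omega> = c + d * \<tau>" if "\<omega> \<in> space M" "?T \<omega> \<le> ereal t" for \<omega>
    using that by (cases rule: hitting_time_cases[where c = c and d = d]) auto
  have f_nonneg: "0 \<le> f \<theta> n \<omega>" for \<theta> n \<omega>
    unfolding f_def E_def by (intro sum_nonneg) auto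
  \<comment> \<open>The square of the exponential martingale for \<theta> at time s is exp
    (\<theta>^2 s) times the one for 2 \<theta>.\<close>
  have sq: "(f \<theta> n \<omega>)\<^sup>2 \<le> exp (\<theta>\<^sup>2 * t) * f (2 * \<theta>) n \<omega>" if \<omega>: "\<omega> \<in> space M" for n \<omega>
  proof (cases "?T \<omega> \<le> ereal t")
    case True
    then obtain \<tau> where "?T \<omega> = ereal \<tau>" "\<tau> \<le> t" using real_T[OF \<omega>] by blast
    then obtain s where s: "s \<le> t" "\<And>\<theta>. f \<theta> n \<omega> = E \<theta> s \<omega>" using f_cases[OF \<omega>] by blast
    have "(f \<theta> n \<omega>)\<^sup>2 = exp (\<theta>\<^sup>2 * s) * f (2 * \<theta>) n \<omega>"
      unfolding s(2) E_def by (simp add: exp_add[symmetric] power2_eq_square algebra_simps)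
    also have "\<dots> \<le> exp (\<theta>\<^sup>2 * t) * f (2 * \<theta>) n \<omega>"
      using s(1) f_nonneg by (intro mult_right_mono) (auto intro: mult_left_mono)
    finally show ?thesis .
  qed (simp add: f_zero \<omega>)
  have f_sq_int: "integrable M (\<lambda>\<omega>. (f \<theta> n \<omega>)\<^sup>2)" for n
  proof (rule Bochner_Integration.integrable_bound)
    show "integrable M (\<lambda>\<omega>. exp (\<theta>\<^sup>2 * t) * f (2 * \<theta>) n \<omega>)"
      using f_int by (rule integrable_mult_right)
    show "(\<lambda>\<omega>. (f \<theta> n \<omega>)\<^sup>2) \<in> borel_measurable M"
      using borel_measurable_integrable[OF f_int] by measurable
    show "AE \<omega> in M. norm ((f \<theta> n \<omega>)\<^sup>2) \<le> norm (exp (\<theta>\<^sup>2 * t) * f (2 * \<theta>) n \<omega>)"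
      using sq f_nonneg by (intro AE_I2) (simp add: abs_mult)
  qed
  have f_sq: "expectation (\<lambda>\<omega>. (f \<theta> n \<omega>)\<^sup>2) \<le> exp (\<theta>\<^sup>2 * t) * expectation (\<lambda>\<omega>. E (2 * \<theta>) t \<omega> * indicator (H t) \<omega>)" for n
  proof -
    have "expectation (\<lambda>\<omega>. (f \<theta> n \<omega>)\<^sup>2) \<le> expectation (\<lambda>\<omega>. exp (\<theta>\<^sup>2 * t) * f (2 * \<theta>) n \<omega>)"
      using f_sq_int f_int sq by (intro integral_mono integrable_mult_right)
    then show ?thesis by (simp add: f_exp)
  qed
  define h where "h = (\<lambda>\<omega>. if ?T \<omega> \<le> ereal t
        then exp (\<theta> * (c + d * real_of_ereal (?T \<omega>)) - \<theta>\<^sup>2 / 2 * real_of_ereal (?T \<omega>)) else 0)"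
  have "expectation h = expectation (\<lambda>\<omega>. E \<theta> t \<omega> * indicator (H t) \<omega>)"
  proof (rule expectation_limit_of_L2_bounded[OF f_int f_sq_int f_nonneg f_exp f_sq])
    fix \<omega> assume \<omega>: "\<omega> \<in> space M"
    show "(\<lambda>n. f \<theta> n \<omega>) \<longlonglongrightarrow> h \<omega>"
    proof (cases "?T \<omega> \<le> ereal t")
      case True
      then obtain \<tau> where \<tau>: "?T \<omega> = ereal \<tau>" "0 \<le> \<tau>" "\<tau> \<le> t" "B \<tau> \<omega> = c + d * \<tau>"
        using real_T[OF \<omega>] by blast
      have "\<forall>n. \<exists>s. 0 \<le> s \<and> \<tau> \<le> s \<and> s \<le> \<tau> + t / real (Suc n) \<and> f \<theta> n \<omega> = E \<theta> s \<omega>"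
        using f_cases[OF \<omega> \<tau>(1,3)] by blast
      from choice[OF this] obtain s where s: "\<And>n. 0 \<le> s n" "\<And>n. \<tau> \<le> s n"
          "\<And>n. s n \<le> \<tau> + t / real (Suc n)" "\<And>n. f \<theta> n \<omega> = E \<theta> (s n) \<omega>" by blast
      have "s \<longlonglongrightarrow> \<tau>"
      proof (rule tendsto_sandwich[OF always_eventually always_eventually])
        show "\<forall>n. \<tau> \<le> s n" "\<forall>n. s n \<le> \<tau> + t / real (Suc n)" using s(2,3) by blast+
        show "(\<lambda>n. \<tau> + t / real (Suc n)) \<longlonglongrightarrow> \<tau>" by real_asymp
      qed (rule tendsto_const)
      moreover have "continuous_on {0..} (\<lambda>s. E \<theta> s \<omega>)"
        unfolding E_def by (intro continuous_intros continuous_on_B[OF \<omega>])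
      ultimately have "(\<lambda>n. E \<theta> (s n) \<omega>) \<longlonglongrightarrow> E \<theta> \<tau> \<omega>"
        using s(1) \<tau>(2) continuous_on_sequentially[of "{0..}" "\<lambda>s. E \<theta> s \<omega>"]
        by (simp add: comp_def)
      then show ?thesis using True \<tau> unfolding s(4) by (simp add: h_def E_def)
    qed (simp add: f_zero[OF \<omega>] h_def)
    show "h \<omega> \<le> exp (\<bar>\<theta>\<bar> * (\<bar>c\<bar> + \<bar>d\<bar> * t))"
    proof (cases "?T \<omega> \<le> ereal t")
      case True
      then obtain \<tau> where \<tau>: "?T \<omega> = ereal \<tau>" "0 \<le> \<tau>" "\<tau> \<le> t"
        using real_T[OF \<omega>] by blast
      have "\<theta> * (c + d * \<tau>) \<le> \<bar>\<theta>\<bar> * \<bar>c + d * \<tau>\<bar>"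
        using abs_ge_self[of "\<theta> * (c + d * \<tau>)"] by (simp add: abs_mult)
      also have "\<dots> \<le> \<bar>\<theta>\<bar> * (\<bar>c\<bar> + \<bar>d\<bar> * t)"
      proof (intro mult_left_mono)
        have "\<bar>d * \<tau>\<bar> \<le> \<bar>d\<bar> * t" using \<tau> by (simp add: abs_mult mult_left_mono)
        then show "\<bar>c + d * \<tau>\<bar> \<le> \<bar>c\<bar> + \<bar>d\<bar> * t" by linarith
      qed simp
      finally have "\<theta> * (c + d * \<tau>) \<le> \<bar>\<theta>\<bar> * (\<bar>c\<bar> + \<bar>d\<bar> * t)" .
      moreover have "0 \<le> \<theta>\<^sup>2 / 2 * \<tau>" using \<tau>(2) by simp
      ultimately have "\<theta> * (c + d * \<tau>) - \<theta>\<^sup>2 / 2 * \<tau> \<le> \<bar>\<theta>\<bar> * (\<bar>c\<bar> + \<bar>d\<bar> * t)"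
        by linarith
      then show ?thesis using True \<tau> by (simp add: h_def)
    qed (simp add: h_def)
  qed
  then show ?thesis unfolding h_def E_def H_def .
qed


lemma real_hitting_time_measurable: "(\<lambda>\<omega>. real_of_ereal (hitting_time B c d \<omega>)) \<in> borel_measurable M"
  using borel_measurable_real_of_ereal[OF hitting_time_measurable] .

lemma value_on_hitting_measurable:
  fixes f :: "'a \<Rightarrow> real"
  assumes "f \<in> borel_measurable M"
  shows "(\<lambda>\<omega>. if hitting_time B c d \<omega> = \<infinity> then 0 else f \<omega>) \<in> borel_measurable M"
proof (rule measurable_If[OF _ assms])
  have "{\<omega> \<in> space M. hitting_time B c d \<omega> = \<infinity>} = hitting_time B c d -` {\<infinity>} \<inter> space M" by auto
  then show "{\<omega> \<in> space M. hitting_time B c d \<omega> = \<infinity>} \<in> events"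
    using measurable_sets[OF hitting_time_measurable, of "{\<infinity>}" c d] by simp
qed simp

lemma discounted_hitting_time_measurable:
  "(\<lambda>\<omega>. if hitting_time B c d \<omega> = \<infinity> then 0 else exp (- l * real_of_ereal (hitting_time B c d \<omega>)))
     \<in> borel_measurable M"
proof (rule value_on_hitting_measurable)
  show "(\<lambda>\<omega>. exp (- l * real_of_ereal (hitting_time B c d \<omega>))) \<in> borel_measurable M"
    using real_hitting_time_measurable[of c d] by measurable
qed

lemma real_hitting_time_nonneg:
  assumes "\<omega> \<in> space M"
  shows "0 \<le> real_of_ereal (hitting_time B c d \<omega>)"
  using assms
proof (cases rule: hitting_time_cases[where c = c and d = d])
  case infinite
  then show ?thesis by simp
next
  case (finite \<tau>)
  then show ?thesis by simp
qed

lemma discounted_hitting_time_integrable: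
  assumes "0 \<le> l"
  shows "integrable M (\<lambda>\<omega>. if hitting_time B c d \<omega> = \<infinity> then 0
    else exp (- l * real_of_ereal (hitting_time B c d \<omega>)))"
proof (rule integrable_const_bound[where B = 1])
  show "AE \<omega> in M. norm (if hitting_time B c d \<omega> = \<infinity> then 0
    else exp (- l * real_of_ereal (hitting_time B c d \<omega>))) \<le> 1"
    using assms real_hitting_time_nonneg[of _ c d] by (intro AE_I2) auto
qed (rule discounted_hitting_time_measurable)

text \<open>\<theta> is the larger root of \<theta>^2/2 = \<theta> d + l, chosen so that the
  exponential martingale on the line equals exp (\<theta> c - l T). Its mass 1 splits into the part
  already stopped by time t and the rest; on the rest the path is below the line and \<theta> \<ge>
  0, so at most exp (\<theta> c - l t) is lost. This loss vanishes as t grows when l > 0; for l = 0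
  only the upper bound remains.\<close>

lemma hitting_time_laplace:
  fixes c d l :: real
  assumes "0 < c" "0 \<le> l"
  defines "L \<equiv> expectation (\<lambda>\<omega>. if hitting_time B c d \<omega> = \<infinity> then 0
      else exp (- l * real_of_ereal (hitting_time B c d \<omega>)))"
    and "\<theta> \<equiv> d + sqrt (d\<^sup>2 + 2 * l)"
  shows "L \<le> exp (- c * \<theta>)" "0 < l \<Longrightarrow> L = exp (- c * \<theta>)"
proof -
  let ?T = "hitting_time B c d"
  define K where "K = (\<lambda>n \<omega>. if ?T \<omega> \<le> ereal (real (Suc n)) then exp (- l * real_of_ereal (?T \<omega>)) else 0)"
  have "\<bar>d\<bar> \<le> sqrt (d\<^sup>2 + 2 * l)"
    using real_sqrt_le_mono[of "d\<^sup>2" "d\<^sup>2 + 2 * l"] assms by simp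
  then have \<theta>: "0 \<le> \<theta>" by (simp add: \<theta>_def)
  have "(\<theta> - d)\<^sup>2 = d\<^sup>2 + 2 * l"
    using assms by (simp add: \<theta>_def)
  then have \<theta>_eq: "\<theta>\<^sup>2 / 2 = \<theta> * d + l"
    by (simp add: power2_diff)
  have bounds: "exp (\<theta> * c) * expectation (K n) \<le> 1 \<and> 1 - exp (\<theta> * c - l * real (Suc n)) \<le> exp (\<theta> * c) * expectation (K n)" for n
  proof -
    define t where "t = real (Suc n)"
    have t: "0 < t" by (simp add: t_def)
    let ?H = "{\<omega> \<in> space M. ?T \<omega> \<le> ereal t}"
    let ?E = "\<lambda>\<omega>. exp (\<theta> * B t \<omega> - \<theta>\<^sup>2 / 2 * t)"
    have H: "?H \<in> events"
      using sets_hitting_time_le[of c d t] subalgebra_F[of t] unfolding subalgebra_def by auto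
    have E_int: "integrable M ?E"
      using t by (intro exponential_martingale(1)[of t t "{}"]) auto
    have "expectation (\<lambda>\<omega>. ?E \<omega> * indicator (space M) \<omega>) =
        expectation (\<lambda>\<omega>. exp (\<theta> * B 0 \<omega> - \<theta>\<^sup>2 / 2 * 0) * indicator (space M) \<omega>)"
      using t sets.top[of "F 0"] space_F by (intro exponential_martingale(2)) auto
    also have "\<dots> = expectation (\<lambda>\<omega>. 1)"
      using B_0 by (intro Bochner_Integration.integral_cong) auto
    finally have "expectation (\<lambda>\<omega>. ?E \<omega> * indicator (space M) \<omega>) = 1" by (simp add: prob_space)
    moreover have "expectation (\<lambda>\<omega>. ?E \<omega> * indicator (space M) \<omega>) = expectation ?E"
      by (intro Bochner_Integration.integral_cong) auto
    ultimately have E_1: "expectation ?E = 1" by simp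
    have EH_int: "integrable M (\<lambda>\<omega>. ?E \<omega> * indicator ?H \<omega>)"
      using E_int H by (intro integrable_real_mult_indicator)
    \<comment> \<open>A path starting at 0 < c that has not met the line by time t is still below
      it, by the intermediate value theorem.\<close>
    have le: "?E \<omega> \<le> ?E \<omega> * indicator ?H \<omega> + exp (\<theta> * c - l * t)" if \<omega>: "\<omega> \<in> space M" for \<omega>
    proof (cases "\<omega> \<in> ?H")
      case False
      have "B t \<omega> < c + d * t"
      proof (rule ccontr)
        assume "\<not> ?thesis"
        moreover have "continuous_on {0..t} (\<lambda>s. B s \<omega> - d * s)"
          by (intro continuous_intros continuous_on_subset[OF continuous_on_B[OF \<omega>]]) auto
        ultimately obtain s where "0 \<le> s" "s \<le> t" "B s \<omega> - d * s = c"
          using IVT'[of "\<lambda>s. B s \<omega> - d * s" 0 c t] t \<open>0 < c\<close> B_0[OF \<omega>] by force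
        then show False
          using False hitting_time_le_iff[OF \<omega>, of c d t] \<omega> by force
      qed
      then have "\<theta> * B t \<omega> \<le> \<theta> * (c + d * t)" using \<theta> by (intro mult_left_mono) auto
      then have "\<theta> * B t \<omega> - \<theta>\<^sup>2 / 2 * t \<le> \<theta> * c - l * t"
        unfolding \<theta>_eq by (simp add: algebra_simps)
      then show ?thesis using False by simp
    qed simp
    have "expectation ?E \<le> expectation (\<lambda>\<omega>. ?E \<omega> * indicator ?H \<omega> + exp (\<theta> * c - l * t))"
      using le E_int EH_int by (intro integral_mono Bochner_Integration.integrable_add) auto
    also have "\<dots> = expectation (\<lambda>\<omega>. ?E \<omega> * indicator ?H \<omega>) + exp (\<theta> * c - l * t)"
      using EH_int by (subst Bochner_Integration.integral_add) (auto simp: prob_space)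
    finally have "1 - exp (\<theta> * c - l * t) \<le> expectation (\<lambda>\<omega>. ?E \<omega> * indicator ?H \<omega>)"
      unfolding E_1 by simp
    moreover have "expectation (\<lambda>\<omega>. ?E \<omega> * indicator ?H \<omega>) \<le> 1"
    proof -
      have "?E \<omega> * indicator ?H \<omega> \<le> ?E \<omega>" for \<omega> by (simp add: indicator_def)
      from integral_mono[OF EH_int E_int this] show ?thesis unfolding E_1 .
    qed
    moreover have "expectation (\<lambda>\<omega>. ?E \<omega> * indicator ?H \<omega>) = exp (\<theta> * c) * expectation (K n)"
    proof -
      have "exp (\<theta> * (c + d * \<tau>) - \<theta>\<^sup>2 / 2 * \<tau>) = exp (\<theta> * c) * exp (- l * \<tau>)" for \<tau>
        unfolding \<theta>_eq exp_add[symmetric] by (simp add: algebra_simps)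
      then have "(if ?T \<omega> \<le> ereal t then exp (\<theta> * (c + d * real_of_ereal (?T \<omega>)) - \<theta>\<^sup>2 / 2 * real_of_ereal (?T \<omega>)) else 0) =
          exp (\<theta> * c) * K n \<omega>" for \<omega>
        unfolding K_def t_def[symmetric] by simp
      then show ?thesis
        using optional_stopping_at_hitting_time[of c t d \<theta>] t \<open>0 < c\<close> by simp
    qed
    ultimately show ?thesis unfolding t_def by simp
  qed
  have "(\<lambda>n. expectation (K n)) \<longlonglongrightarrow> L"
    unfolding L_def
  proof (rule integral_dominated_convergence[where w = "\<lambda>_. 1"])
    show "K n \<in> borel_measurable M" for n
      unfolding K_def
    proof (rule measurable_If)
      show "(\<lambda>\<omega>. exp (- l * real_of_ereal (?T \<omega>))) \<in> borel_measurable M"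
        using real_hitting_time_measurable[of c d] by measurable
      show "{\<omega> \<in> space M. ?T \<omega> \<le> ereal (real (Suc n))} \<in> events"
        using sets_hitting_time_le[of c d "real (Suc n)"] subalgebra_F[of "real (Suc n)"]
        unfolding subalgebra_def by blast
    qed simp
    show "AE \<omega> in M. norm (K n \<omega>) \<le> 1" for n
      using real_hitting_time_nonneg[of _ c d] \<open>0 \<le> l\<close> by (intro AE_I2) (auto simp: K_def)
    show "AE \<omega> in M. (\<lambda>n. K n \<omega>) \<longlonglongrightarrow> (if ?T \<omega> = \<infinity> then 0 else exp (- l * real_of_ereal (?T \<omega>)))"
    proof (rule AE_I2)
      fix \<omega> assume "\<omega> \<in> space M"
      then show "(\<lambda>n. K n \<omega>) \<longlonglongrightarrow> (if ?T \<omega> = \<infinity> then 0 else exp (- l * real_of_ereal (?T \<omega>)))"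
      proof (cases rule: hitting_time_cases[where c = c and d = d])
        case infinite
        then show ?thesis by (simp add: K_def)
      next
        case (finite \<tau>)
        obtain n0 :: nat where n0: "\<tau> \<le> real n0" using real_arch_simple by blast
        have "\<forall>\<^sub>F n in sequentially. exp (- l * \<tau>) = K n \<omega>"
          using eventually_ge_at_top[of n0]
        proof eventually_elim
          case (elim n)
          then have "\<tau> \<le> real (Suc n)" using n0 by simp
          then show ?case by (simp add: K_def finite)
        qed
        then have "(\<lambda>n. K n \<omega>) \<longlonglongrightarrow> exp (- l * \<tau>)"
          by (rule Lim_transform_eventually[OF tendsto_const])
        then show ?thesis by (simp add: finite)
      qed
    qed
  qed (use discounted_hitting_time_measurable in auto)
  then have lim: "(\<lambda>n. exp (\<theta> * c) * expectation (K n)) \<longlonglongrightarrow> exp (\<theta> * c) * L"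
    by (intro tendsto_intros)
  have le: "exp (\<theta> * c) * L \<le> 1"
    by (rule LIMSEQ_le_const2[OF lim]) (use bounds in auto)
  then show "L \<le> exp (- c * \<theta>)"
    by (simp add: exp_minus field_simps)
  assume "0 < l"
  then have "(\<lambda>n. 1 - exp (\<theta> * c - l * real (Suc n))) \<longlonglongrightarrow> 1" by real_asymp
  then have "1 \<le> exp (\<theta> * c) * L"
    by (rule LIMSEQ_le[OF _ lim]) (use bounds in auto)
  with le show "L = exp (- c * \<theta>)"
    by (simp add: exp_minus field_simps)
qed

lemma hitting_time_finite_pos_prob:
  assumes "c < 0" "0 < d"
  shows "\<not> (AE \<omega> in M. hitting_time B c d \<omega> = \<infinity>)"
proof
  assume inf: "AE \<omega> in M. hitting_time B c d \<omega> = \<infinity>"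
  \<comment> \<open>With this choice c + d t = d > 0, while a path that never meets the line stays
    above it because it starts at 0 > c.\<close>
  define t where "t = 1 - c / d"
  have t: "0 < t" "0 < c + d * t"
    using assms by (auto simp: t_def field_simps add_strict_mono divide_neg_pos)
  have int: "integrable M (\<lambda>\<omega>. 0 + 1 * (B t \<omega> - B 0 \<omega>))"
    and exp0: "expectation (\<lambda>\<omega>. 0 + 1 * (B t \<omega> - B 0 \<omega>)) = 0"
    using increment_affine(1,2)[of 0 t 0 1] t by auto
  have "expectation (\<lambda>\<omega>. c + d * t) \<le> expectation (\<lambda>\<omega>. 0 + 1 * (B t \<omega> - B 0 \<omega>))"
  proof (rule integral_mono_AE)
    show "AE \<omega> in M. c + d * t \<le> 0 + 1 * (B t \<omega> - B 0 \<omega>)"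
      using inf AE_space
    proof eventually_elim
      case (elim \<omega>)
      show ?case
      proof (rule ccontr)
        assume "\<not> ?thesis"
        then have less: "B t \<omega> < c + d * t" using B_0[OF elim(2)] by simp
        have "continuous_on {0..t} (\<lambda>s. d * s - B s \<omega>)"
          by (intro continuous_intros continuous_on_subset[OF continuous_on_B[OF elim(2)]]) auto
        then obtain s where "0 \<le> s" "s \<le> t" "d * s - B s \<omega> = - c"
          using IVT'[of "\<lambda>s. d * s - B s \<omega>" 0 "- c" t] t less \<open>c < 0\<close> B_0[OF elim(2)] by force
        then have "hitting_time B c d \<omega> \<le> ereal t"
          using hitting_time_le_iff[OF elim(2), of c d t] by force
        with elim(1) show False by simp
      qed
    qed
  qed (use int in auto)
  then show False using t unfolding exp0 by (simp add: prob_space)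
qed

end

section \<open>The sign of the expected payoff\<close>

theorem proposition4p5:
  fixes M :: "'a measure" and F :: "real \<Rightarrow> 'a measure"
    and B P :: "real \<Rightarrow> 'a \<Rightarrow> real"
    and g \<sigma> m r \<rho> P0 c d :: real
  assumes "brownian_motion M F B"
    and "g \<ge> 0" and "\<sigma> > 0" and "m > 0" and "r \<ge> 0" and "\<rho> \<ge> 0"
    and "price_process M F B g \<sigma> P0 P"
    and "(P0 = 1 \<and> g = 0 \<and> r > 0) \<or> (P0 > 1 \<and> g > 0 \<and> r = 0)"
    and "r + g - \<rho> - m > ln P0" and "ln P0 > 0"
    and "(\<sigma> / 2 - g / \<sigma>)\<^sup>2 - 2 * (g + r - m - \<rho>) > 0"
    and "(\<sigma> / 2 - g / \<sigma>)\<^sup>2 - (g - 1 / 4 * \<sigma>\<^sup>2 - m - 2 * \<rho>) > 0"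
    and "d = \<sigma> / 2 - g / \<sigma>" and "d > 0"
    and "1 / 4 * \<sigma>\<^sup>2 - m > 0"
    and "c \<noteq> 0"
  shows "(c < 0 \<longrightarrow>
            prob_space.expectation M (value_at (hitting_time B c d) (ST \<rho> m r P0) P) > 0) \<and>
         (c > 0 \<longrightarrow>
            prob_space.expectation M (value_at (hitting_time B c d) (ST \<rho> m r P0) P) < 0)"
proof -
  interpret brownian_motion M F B by fact
  let ?T = "hitting_time B c d"
  have "r = 0" "P0 > 1" using assms(8,10) by auto
  define D where "D = (\<lambda>l \<omega>. if ?T \<omega> = \<infinity> then 0 else exp (- l * real_of_ereal (?T \<omega>)))"
  define V where "V = (\<lambda>\<omega>. - (1 / 2) * (exp (\<sigma> * c) * D (m + \<rho>) \<omega> - D \<rho> \<omega>))"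
  have D_int: "integrable M (D l)" if "0 \<le> l" for l
    unfolding D_def by (rule discounted_hitting_time_integrable[OF that])
  have V_int: "integrable M V"
    unfolding V_def using D_int assms(4,6)
    by (intro integrable_mult_right Bochner_Integration.integrable_diff) auto
  have value_m: "value_at ?T (ST \<rho> m r P0) P \<in> borel_measurable M"
  proof -
    \<comment> \<open>The maximum with 0 makes the time nonnegative at every point, also outside
      \<open>space M\<close>, as the measurability of the stopped price demands; on
      \<open>space M\<close> it changes nothing.\<close>
    define \<tau> where "\<tau> = (\<lambda>\<omega>. max 0 (real_of_ereal (?T \<omega>)))"
    have \<tau>[measurable]: "\<tau> \<in> borel_measurable M"
      unfolding \<tau>_def using real_hitting_time_measurable[of c d] by measurable
    have [measurable]: "(\<lambda>\<omega>. P (\<tau> \<omega>) \<omega>) \<in> borel_measurable M"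
    proof (rule measurable_process_at_random_time[OF _ _ \<tau>])
      have P: "continuous_adapted M F P" using assms(7) unfolding price_process_def by blast
      show "P s \<in> borel_measurable M" if "0 \<le> s" for s
        using P that measurable_F[of "P s" s] unfolding continuous_adapted_def by blast
      show "continuous_on {0..} (\<lambda>s. P s \<omega>)" if "\<omega> \<in> space M" for \<omega>
        using P that unfolding continuous_adapted_def by blast
    qed (simp add: \<tau>_def)
    have "(\<lambda>\<omega>. if ?T \<omega> = \<infinity> then 0 else ST \<rho> m r P0 (\<tau> \<omega>) (P (\<tau> \<omega>) \<omega>)) \<in> borel_measurable M"
      by (rule value_on_hitting_measurable) (unfold ST_def discount_def, measurable)
    moreover have "value_at ?T (ST \<rho> m r P0) P \<omega> =
        (if ?T \<omega> = \<infinity> then 0 else ST \<rho> m r P0 (\<tau> \<omega>) (P (\<tau> \<omega>) \<omega>))" if "\<omega> \<in> space M" for \<omega>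
      using real_hitting_time_nonneg[OF that, of c d] by (simp add: value_at_def \<tau>_def max_absorb2)
    ultimately show ?thesis by (simp cong: measurable_cong)
  qed
  have "AE \<omega> in M. value_at ?T (ST \<rho> m r P0) P \<omega> = V \<omega>"
    using price_eq_exponential[OF assms(7)] AE_space
  proof eventually_elim
    case (elim \<omega>)
    from elim(2) show ?case
    proof (cases rule: hitting_time_cases[where c = c and d = d])
      case infinite
      then show ?thesis by (simp add: value_at_def V_def D_def)
    next
      case (finite \<tau>)
      \<comment> \<open>Since \<sigma> d = \<sigma>^2/2 - g, the drift of the line cancels the drift
        in the exponent.\<close>
      have "\<sigma> * B \<tau> \<omega> + (g - \<sigma>\<^sup>2 / 2) * \<tau> = \<sigma> * c"
        using \<open>\<sigma> > 0\<close> unfolding finite(3) assms(13) by (simp add: field_simps power2_eq_square)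
      then have "P \<tau> \<omega> = P0 * exp (\<sigma> * c)"
        using elim(1) finite(2) by simp
      then show ?thesis
        using \<open>P0 > 1\<close> \<open>r = 0\<close>
        by (simp add: value_at_def V_def D_def finite ST_def discount_def exp_add[symmetric] algebra_simps)
    qed
  qed
  then have value_eq: "expectation (value_at ?T (ST \<rho> m r P0) P) = expectation V"
    using value_m V_int by (intro integral_cong_AE) auto
  have neg: "0 < expectation V" if "c < 0"
  proof -
    have V_pos: "0 < V \<omega>" if "\<omega> \<in> space M" "?T \<omega> \<noteq> \<infinity>" for \<omega>
    proof -
      let ?\<tau> = "real_of_ereal (?T \<omega>)"
      have "\<sigma> * c < 0" using \<open>c < 0\<close> \<open>\<sigma> > 0\<close> by (simp add: mult_pos_neg)
      moreover have "0 \<le> m * ?\<tau>"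
        using real_hitting_time_nonneg[OF that(1), of c d] \<open>m > 0\<close> by simp
      ultimately have "exp (\<sigma> * c + - (m + \<rho>) * ?\<tau>) < exp (- \<rho> * ?\<tau>)"
        by (simp add: algebra_simps)
      then show ?thesis using that(2) by (simp add: V_def D_def exp_add)
    qed
    have V_0: "V \<omega> = 0" if "?T \<omega> = \<infinity>" for \<omega> using that by (simp add: V_def D_def)
    have nonneg: "AE \<omega> in M. 0 \<le> V \<omega>"
      using V_pos V_0 by (intro AE_I2) (metis less_imp_le order_refl)
    have "expectation V \<noteq> 0"
    proof
      assume "expectation V = 0"
      then have "AE \<omega> in M. V \<omega> = 0"
        using integral_nonneg_eq_0_iff_AE[OF V_int nonneg] by simp
      then have "AE \<omega> in M. ?T \<omega> = \<infinity>"
        using AE_space by eventually_elim (use V_pos in force)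
      then show False using hitting_time_finite_pos_prob[OF that \<open>d > 0\<close>] by blast
    qed
    moreover have "0 \<le> expectation V" using nonneg by (rule integral_nonneg_AE)
    ultimately show ?thesis by simp
  qed
  have pos: "expectation V < 0" if "0 < c"
  proof -
    define R S where "R = sqrt (d\<^sup>2 + 2 * (m + \<rho>))" and "S = sqrt (d\<^sup>2 + 2 * \<rho>)"
    have S: "0 \<le> S" "S\<^sup>2 = d\<^sup>2 + 2 * \<rho>" using \<open>\<rho> \<ge> 0\<close> by (auto simp: S_def)
    \<comment> \<open>After squaring, the claim is 2 m < 2 S \<sigma> + \<sigma>^2, and 2 m <
      \<sigma>^2/2 by the bound on \<open>m\<close>.\<close>
    have "R < S + \<sigma>"
      unfolding R_def
    proof (rule real_less_lsqrt)
      have "0 \<le> S * \<sigma>" "0 \<le> \<sigma>\<^sup>2" using S(1) \<open>\<sigma> > 0\<close> by auto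
      then show "d\<^sup>2 + 2 * (m + \<rho>) < (S + \<sigma>)\<^sup>2"
        using S(2) assms(4,15) by (simp add: power2_sum)
    qed (use S \<open>\<sigma> > 0\<close> in auto)
    then have "c * (d + R) < c * (d + S) + c * \<sigma>"
      using \<open>0 < c\<close> by (simp add: distrib_left[symmetric])
    then have "exp (- c * (d + S)) < exp (\<sigma> * c) * exp (- c * (d + R))"
      by (simp add: exp_add[symmetric] algebra_simps)
    moreover have "expectation (D (m + \<rho>)) = exp (- c * (d + R))"
      unfolding D_def R_def using hitting_time_laplace(2)[OF that, of "m + \<rho>" d] assms(4,6) by simp
    \<comment> \<open>This term enters the payoff with a positive sign, so the upper bound suffices
      and also covers \<rho> = 0.\<close>
    moreover have "expectation (D \<rho>) \<le> exp (- c * (d + S))"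
      unfolding D_def S_def by (rule hitting_time_laplace(1)[OF that \<open>\<rho> \<ge> 0\<close>])
    moreover have "expectation V = - (1 / 2) * (exp (\<sigma> * c) * expectation (D (m + \<rho>)) - expectation (D \<rho>))"
      unfolding V_def using D_int assms(4,6) by simp
    ultimately show ?thesis by simp
  qed
  show ?thesis unfolding value_eq using neg pos by blast
qed

end
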